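(* Let $n\ge 2$ be an integer. Let $G$ be a $k$-connected simple graph with $g$ even, where $g=|V(G)|$. Let $u$ and $v$ be non-adjacent vertices of $G$ such that \[ |\,N_G(u)\cup N_G(v)\,|\ge g-2nk. \] Then $G$ has an $H_n$-factor if and only if the graph $G+uv$ has an $H_n$-factor. Moreover, the lower bound $g-2nk$ in the displayed inequality is best possible.
   Context: For an integer $n\ge 2$, an $H_n$-factor of a graph $G$ is a spanning subgraph $F$ of $G$ such that $d_F(v)\in\{1,3,5,\ldots,2n-1,2n\}$ for every vertex $v\in V(G)$, where $d_F(v)$ is the degree of $v$ in $F$. $N_G(v)$ denotes the set of neighbors of $v$ in $G$. For a positive integer $k$, a graph is said to be $k$-connected if it is connected when fewer than $k$ vertices are removed from it. For non-adjacent vertices $u,v$ of $G$, $G+uv$ denotes the graph obtained from $G$ by adding the edge joining $u$ and $v$.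
   Formalization: "Best possible" is proved for every n ≥ 2 and every odd k (the equivalence can fail when the union has exactly g-2nk-1 vertices); for even k that claim is false, since g even then forces the equivalence to hold at g-2nk-1 too. *)

theory Defs
  imports Graph_Theory.Graph_Theory
begin

text \<open>
  Finite simple graphs are the symmetric, loop-free finite digraphs without parallel arcs of
  \<^locale>\<open>pair_graph\<close>: an edge joining \<open>u\<close> and \<open>v\<close> is the pair of arcs \<open>(u, v)\<close>, \<open>(v, u)\<close>, so
  the degree of a vertex is its \<^const>\<open>out_degree\<close>.
\<close>

definition neighbors :: "'a pair_pre_digraph \<Rightarrow> 'a \<Rightarrow> 'a set" where
  "neighbors G v = {w. v \<rightarrow>\<^bsub>with_proj G\<^esub> w}"

definition add_edge :: "'a pair_pre_digraph \<Rightarrow> 'a \<Rightarrow> 'a \<Rightarrow> 'a pair_pre_digraph" where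
  "add_edge G u v = \<lparr>pverts = pverts G, parcs = parcs G \<union> {(u, v), (v, u)}\<rparr>"

text \<open>
  Some authors also require more than \<open>k\<close> vertices. For a graph with two distinct
  non-adjacent vertices that is automatic: if there were at most \<open>k + 1\<close> vertices, deleting all
  the others would leave a disconnected graph. (The library's \<^const>\<open>connected\<close> excludes the
  empty graph.)
\<close>

definition k_connected :: "nat \<Rightarrow> 'a pair_pre_digraph \<Rightarrow> bool" where
  "k_connected k G \<longleftrightarrow>
     (\<forall>S \<subseteq> pverts G. card S < k \<longrightarrow> connected (with_proj G \<restriction> (pverts G - S)))"

definition H_set :: "nat \<Rightarrow> nat set" where
  "H_set n = {d. odd d \<and> d \<le> 2 * n - 1} \<union> {2 * n}"

definition H_factor :: "nat \<Rightarrow> 'a pair_pre_digraph \<Rightarrow> 'a pair_pre_digraph \<Rightarrow> bool" where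
  "H_factor n F G \<longleftrightarrow>
     pair_graph F \<and> spanning (with_proj F) (with_proj G) \<and>
     (\<forall>v \<in> pverts G. out_degree (with_proj F) v \<in> H_set n)"

definition has_H_factor :: "nat \<Rightarrow> 'a pair_pre_digraph \<Rightarrow> bool" where
  "has_H_factor n G \<longleftrightarrow> (\<exists>F. H_factor n F G)"

text \<open>
  \<open>G\<close> is a \<open>k\<close>-connected simple graph of even order with distinct non-adjacent vertices
  \<open>u\<close>, \<open>v\<close>.
\<close>

definition admissible :: "nat \<Rightarrow> 'a pair_pre_digraph \<Rightarrow> 'a \<Rightarrow> 'a \<Rightarrow> bool" where
  "admissible k G u v \<longleftrightarrow>
     pair_graph G \<and> k_connected k G \<and> even (card (pverts G)) \<and>
     u \<in> pverts G \<and> v \<in> pverts G \<and> u \<noteq> v \<and> \<not> u \<rightarrow>\<^bsub>with_proj G\<^esub> v"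

end

theory Submission
  imports Defs
begin

text \<open>
  The heart of the matter is a Tutte-type criterion. Call a component of odd order bad if it has
  no \<open>H\<^sub>n\<close>-factor of its own. In an \<open>H\<^sub>n\<close>-factor of \<open>G\<close>, every bad component of \<open>G - S\<close> must send
  an edge to \<open>S\<close>, and \<open>S\<close> can absorb at most \<open>2n|S|\<close> edges; so \<open>G - S\<close> has at most \<open>2n|S|\<close> bad
  components. For a connected graph of even order the converse holds as well: if every nonempty
  \<open>S\<close> obeys this bound, an \<open>H\<^sub>n\<close>-factor exists (\<open>factorable_of_tutte_condition\<close>).

  Granted the criterion, suppose that \<open>G\<close> has no factor while \<open>G + uv\<close> has one, and take a
  nonempty \<open>S\<close> with more than \<open>2n|S|\<close> bad components in \<open>G - S\<close>. If \<open>u\<close> or \<open>v\<close> lies in \<open>S\<close>, the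
  graphs \<open>G + uv - S\<close> and \<open>G - S\<close> coincide, and counting the edges of the factor of \<open>G + uv\<close>
  at \<open>S\<close> gives a contradiction. Otherwise \<open>u\<close> and \<open>v\<close> lie in components, and one vertex from
  each remaining component, together with \<open>u\<close> and \<open>v\<close>, is outside \<open>N(u) \<union> N(v)\<close>; as \<open>G - S\<close>
  is disconnected, \<open>|S| \<ge> k\<close>, so there are more than \<open>2nk\<close> such vertices, against the degree
  hypothesis. It matters here that bad components are counted, not all odd ones: an odd component
  with a factor of its own need not be joined to \<open>S\<close>, and the first case would break down.

  The criterion is proved by induction on the order and then on the number of edges. The bound
  \<open>2n|S|\<close> is attained, or missed by one, for some nonempty \<open>S\<close>, or it is missed by two or more
  for all of them.

  In the first case choose such an \<open>S\<close> with maximal excess and then of maximal size. By induction,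
  all components of \<open>G - S\<close> that are not bad have factors, and every bad component \<open>K\<close> becomes
  factorable as soon as one arbitrary vertex of \<open>K\<close> is given an edge leading out of \<open>K\<close>
  (\<open>pendant_factor_exists\<close>). Hall's theorem assigns the bad components to neighbours in \<open>S\<close>, at
  most \<open>2n\<close> to each; as there are at least \<open>2n|S| - 1\<close> of them, each vertex of \<open>S\<close> gets
  \<open>2n\<close> or \<open>2n - 1\<close>, and both of these are elements of \<open>H\<^sub>n\<close>. This is where the two consecutive
  values at the top of \<open>H\<^sub>n\<close> are used (\<open>factorable_of_near_tight\<close>).

  In the second case the deletion of one edge creates at most two new bad components, so the
  bounds survive, and induction leaves only the graphs in which every edge is a bridge that
  separates two sides of odd order. In such a tree all degrees are odd, and the tree is its own
  factor unless some \<open>x\<close> has degree at least \<open>2n + 1\<close>. Then at least two branches at \<open>x\<close> are not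
  bad; they are split off with their own factors, and induction applies to the rest
  (\<open>factorable_of_slack\<close>).

  For sharpness, join \<open>k\<close> mutually adjacent vertices completely to \<open>2nk + 1\<close> independent ones:
  the latter are too many bad components, but an edge between two of them leaves \<open>2nk - 1\<close>,
  which the \<open>k\<close> hubs can serve.
\<close>

section \<open>Components defined by cuts\<close>

text \<open>
  Connectedness of the subgraph induced by \<open>W\<close>, expressed by cuts instead of paths. Only the edge
  across a cut is ever needed below, and in this form the edge set and the vertex set can be
  changed independently of each other.
\<close>

definition cut_connected :: "('a \<times> 'a) set \<Rightarrow> 'a set \<Rightarrow> bool" where
  "cut_connected E W \<longleftrightarrow> W \<noteq> {} \<and>
     (\<forall>A. A \<subseteq> W \<longrightarrow> A \<noteq> {} \<longrightarrow> A \<noteq> W \<longrightarrow> (\<exists>a\<in>A. \<exists>b\<in>W - A. (a, b) \<in> E))"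

definition components :: "('a \<times> 'a) set \<Rightarrow> 'a set \<Rightarrow> 'a set set" where
  "components E W = {C. C \<subseteq> W \<and> cut_connected E C \<and> (\<forall>a\<in>C. \<forall>b\<in>W - C. (a, b) \<notin> E)}"

lemma componentsD:
  assumes "C \<in> components E W"
  shows "C \<subseteq> W" "cut_connected E C" "C \<noteq> {}" "\<And>a b. a \<in> C \<Longrightarrow> b \<in> W \<Longrightarrow> (a, b) \<in> E \<Longrightarrow> b \<in> C"
  using assms unfolding components_def cut_connected_def by blast+

lemma cut_connectedE:
  assumes "cut_connected E W" "A \<subseteq> W" "A \<noteq> {}" "A \<noteq> W"
  obtains a b where "a \<in> A" "b \<in> W" "b \<notin> A" "(a, b) \<in> E"
  using assms unfolding cut_connected_def by blast

lemma cut_connected_cong: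
  assumes "E \<inter> W \<times> W = E' \<inter> W \<times> W"
  shows "cut_connected E W \<longleftrightarrow> cut_connected E' W"
proof -
  have "(a, b) \<in> E \<longleftrightarrow> (a, b) \<in> E'" if "a \<in> W" "b \<in> W" for a b using assms that by blast
  then show ?thesis unfolding cut_connected_def by (meson DiffD1 subsetD)
qed

lemma component_eqI:
  assumes "C \<in> components E W" "D \<in> components E W" "x \<in> C" "x \<in> D"
  shows "C = D"
proof -
  have "C' \<subseteq> D'" if C': "C' \<in> components E W" and D': "D' \<in> components E W"
    and x: "x \<in> C'" "x \<in> D'" for C' D'
  proof (rule ccontr)
    assume "\<not> C' \<subseteq> D'"
    then obtain a b where "a \<in> C' \<inter> D'" "b \<in> C'" "b \<notin> C' \<inter> D'" "(a, b) \<in> E"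
      using cut_connectedE[OF componentsD(2)[OF C'], of "C' \<inter> D'"] x by blast
    then show False
      using componentsD(1)[OF C'] componentsD(4)[OF D'] by blast
  qed
  then show ?thesis using assms by blast
qed

lemma components_disjoint: "pairwise disjnt (components E W)"
  by (auto simp: pairwise_def disjnt_iff dest: component_eqI)

lemma finite_components: "finite W \<Longrightarrow> finite (components E W)"
  by (rule finite_subset[of _ "Pow W"]) (auto simp: components_def)

text \<open>
  A smallest closed set containing \<open>x\<close> is connected: a cut of it without crossing edges would
  leave a smaller closed set around \<open>x\<close>.
\<close>

lemma component_exists:
  assumes fin: "finite W" and sym: "sym E" and x: "x \<in> W"
  obtains C where "C \<in> components E W" "x \<in> C"
proof -
  define P where "P C \<longleftrightarrow> C \<subseteq> W \<and> x \<in> C \<and> (\<forall>a\<in>C. \<forall>b\<in>W - C. (a, b) \<notin> E)" for C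
  have "P W" using x by (auto simp: P_def)
  then obtain C where C: "P C" and min: "\<And>D. P D \<Longrightarrow> card C \<le> card D"
    using ex_has_least_nat[of P W card] by blast
  have finC: "finite C" using C fin finite_subset unfolding P_def by blast
  have "\<exists>a\<in>A. \<exists>b\<in>C - A. (a, b) \<in> E" if A: "A \<subseteq> C" "A \<noteq> {}" "A \<noteq> C" for A
  proof (rule ccontr)
    assume no: "\<not> (\<exists>a\<in>A. \<exists>b\<in>C - A. (a, b) \<in> E)"
    have no': "\<not> (\<exists>a\<in>C - A. \<exists>b\<in>A. (a, b) \<in> E)" using no symD[OF sym] by blast
    define D where "D = (if x \<in> A then A else C - A)"
    have "D \<subseteq> C" "x \<in> D" using A C unfolding D_def P_def by auto
    moreover have "(a, b) \<notin> E" if "a \<in> D" "b \<in> W - D" for a b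
    proof (cases "b \<in> C")
      case True
      then show ?thesis using that no no' unfolding D_def by (auto split: if_splits)
    next
      case False
      then show ?thesis using that C \<open>D \<subseteq> C\<close> unfolding P_def by blast
    qed
    ultimately have "P D" using C unfolding P_def by blast
    moreover have "D \<subset> C" using A unfolding D_def by auto
    ultimately show False using min[of D] psubset_card_mono[OF finC, of D] by linarith
  qed
  then have "cut_connected E C" using C unfolding cut_connected_def P_def by blast
  then have "C \<in> components E W" using C unfolding components_def P_def by blast
  then show thesis using that C unfolding P_def by blast
qed

lemma Union_components: "finite W \<Longrightarrow> sym E \<Longrightarrow> \<Union> (components E W) = W"
  using component_exists[of W E] componentsD(1)[of _ E W] by blast

lemma Union_components_Diff:
  assumes "\<C> \<subseteq> components E X"
  shows "\<Union> (components E X - \<C>) = \<Union> (components E X) - \<Union>\<C>"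
proof -
  have "x \<notin> D" if "x \<in> C" "C \<in> components E X - \<C>" "D \<in> \<C>" for x C D
    using that assms component_eqI[of C E X D x] by blast
  then show ?thesis by blast
qed

lemma components_cut_connected:
  assumes "cut_connected E W"
  shows "components E W = {W}"
proof -
  have W: "W \<in> components E W" using assms by (auto simp: components_def)
  have "C = W" if C: "C \<in> components E W" for C
  proof -
    obtain x where "x \<in> C" using componentsD(3)[OF C] by blast
    then show ?thesis using component_eqI[OF C W] componentsD(1)[OF C] by blast
  qed
  then show ?thesis using W by blast
qed

text \<open>
  When nothing joins \<open>X\<close> to \<open>Y\<close>, a connected set cannot meet both, as \<open>X\<close> would cut it.
\<close>

lemma components_Un:
  assumes sym: "sym E" and cut: "\<And>a b. a \<in> X \<Longrightarrow> b \<in> Y \<Longrightarrow> (a, b) \<notin> E"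
  shows "components E (X \<union> Y) = components E X \<union> components E Y"
proof -
  have cut': "(b, a) \<notin> E" if "a \<in> X" "b \<in> Y" for a b using cut that symD[OF sym] by blast
  have "C \<subseteq> X \<or> C \<subseteq> Y" if C: "C \<in> components E (X \<union> Y)" for C
  proof (rule ccontr)
    assume "\<not> (C \<subseteq> X \<or> C \<subseteq> Y)"
    then obtain a b where "a \<in> C \<inter> X" "b \<in> C" "b \<notin> C \<inter> X" "(a, b) \<in> E"
      using cut_connectedE[OF componentsD(2)[OF C], of "C \<inter> X"] componentsD(1)[OF C] by blast
    then show False using cut componentsD(1)[OF C] by blast
  qed
  then have "C \<in> components E X \<union> components E Y" if "C \<in> components E (X \<union> Y)" for C
    using that unfolding components_def by blast
  moreover have "C \<in> components E (X \<union> Y)" if "C \<in> components E X" for C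
    using that cut unfolding components_def by blast
  moreover have "C \<in> components E (X \<union> Y)" if "C \<in> components E Y" for C
    using that cut' unfolding components_def by blast
  ultimately show ?thesis by blast
qed

text \<open>
  Connectedness passes to a part that can be left only through the single vertex \<open>c\<close>: of the two
  sides of a cut of \<open>Q\<close>, the one without \<open>c\<close> has an edge leaving it in \<open>W\<close>, and that edge must
  stay in \<open>Q\<close>. Both sides of a bridge are of this kind, and so is what remains after branches at a
  cut vertex have been removed.
\<close>

lemma cut_connected_of_gate:
  assumes sym: "sym E" and conn: "cut_connected E W" and Q: "Q \<subseteq> W" "c \<in> Q"
    and gate: "\<And>v w. v \<in> Q \<Longrightarrow> w \<in> W - Q \<Longrightarrow> (v, w) \<in> E \<Longrightarrow> v = c"
  shows "cut_connected E Q"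
  unfolding cut_connected_def
proof (intro conjI allI impI)
  fix A assume A: "A \<subseteq> Q" "A \<noteq> {}" "A \<noteq> Q"
  have away: "\<exists>a\<in>B. \<exists>b\<in>Q - B. (a, b) \<in> E" if B: "B \<subseteq> Q" "B \<noteq> {}" "c \<notin> B" for B
  proof -
    have "B \<noteq> W" "B \<subseteq> W" using B Q by blast+
    then obtain a b where ab: "a \<in> B" "b \<in> W" "b \<notin> B" "(a, b) \<in> E"
      using cut_connectedE[OF conn _ B(2)] by blast
    then have "b \<in> Q" using gate[of a b] B by blast
    then show ?thesis using ab by blast
  qed
  show "\<exists>a\<in>A. \<exists>b\<in>Q - A. (a, b) \<in> E"
  proof (cases "c \<in> A")
    case True
    then obtain a b where "a \<in> Q - A" "b \<in> Q - (Q - A)" "(a, b) \<in> E"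
      using away[of "Q - A"] A by blast
    then show ?thesis using symD[OF sym] by blast
  next
    case False
    then show ?thesis using away[of A] A by blast
  qed
qed (use Q in blast)

lemma bridge_split:
  assumes sym: "sym E" and conn: "cut_connected E W"
    and cut: "\<not> cut_connected (E - {(a, b), (b, a)}) W"
  obtains P where "P \<subseteq> W" "a \<in> P" "b \<in> W - P"
    "\<And>v w. v \<in> P \<Longrightarrow> w \<in> W - P \<Longrightarrow> (v, w) \<in> E \<Longrightarrow> v = a \<and> w = b"
proof -
  have "W \<noteq> {}" using conn by (auto simp: cut_connected_def)
  then obtain A where A: "A \<subseteq> W" "A \<noteq> {}" "A \<noteq> W"
      and only: "\<And>v w. v \<in> A \<Longrightarrow> w \<in> W - A \<Longrightarrow> (v, w) \<in> E \<Longrightarrow> (v, w) = (a, b) \<or> (v, w) = (b, a)"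
    using cut unfolding cut_connected_def by blast
  obtain v w where vw: "v \<in> A" "w \<in> W" "w \<notin> A" "(v, w) \<in> E"
    using cut_connectedE[OF conn A] by blast
  show thesis
  proof (cases "(v, w) = (a, b)")
    case True
    then show thesis using that[of A] A(1) vw only by blast
  next
    case False
    then have "v = b" "w = a" using only[of v w] vw by blast+
    show thesis
    proof (rule that[of "W - A"])
      fix v' w' assume "v' \<in> W - A" "w' \<in> W - (W - A)" "(v', w') \<in> E"
      then have "(w', v') = (a, b) \<or> (w', v') = (b, a)"
        using only[of w' v'] symD[OF sym] A(1) by blast
      then show "v' = a \<and> w' = b"
        using \<open>v = b\<close> \<open>w = a\<close> vw \<open>v' \<in> W - A\<close> by blast
    qed (use vw A(1) \<open>v = b\<close> \<open>w = a\<close> in blast)+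
  qed
qed

lemma odd_card_of_odd_components:
  assumes "finite X" "sym E" "\<And>C. C \<in> components E X \<Longrightarrow> odd (card C)" "odd (card X)"
  shows "odd (card (components E X))"
proof -
  have "card X = card (\<Union> (components E X))" by (simp add: Union_components[OF assms(1,2)])
  also have "\<dots> = sum card (components E X)"
    using finite_subset[OF componentsD(1) assms(1)]
    by (intro card_Union_disjoint components_disjoint)
  finally have "odd (sum card (components E X))" using assms(4) by simp
  then have "odd (card {C \<in> components E X. odd (card C)})"
    by (simp only: even_sum_iff[OF finite_components[OF assms(1)]] not_False_eq_True)
  moreover have "{C \<in> components E X. odd (card C)} = components E X" using assms(3) by blast
  ultimately show ?thesis by (simp only: not_False_eq_True)
qed

section \<open>Factors of induced subgraphs\<close>

lemma zero_notin_H_set: "n \<ge> 1 \<Longrightarrow> 0 \<notin> H_set n"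
  by (auto simp: H_set_def)

lemma H_set_le: "d \<in> H_set n \<Longrightarrow> d \<le> 2 * n"
  by (auto simp: H_set_def)

text \<open>
  Stated for the subgraph induced by \<open>W\<close>, so that the parts of a graph and the whole graph refer
  to the same arc set.
\<close>

definition factorable :: "nat \<Rightarrow> ('a \<times> 'a) set \<Rightarrow> 'a set \<Rightarrow> bool" where
  "factorable n E W \<longleftrightarrow>
     (\<exists>F \<subseteq> E \<inter> W \<times> W. sym F \<and> (\<forall>v\<in>W. card (F `` {v}) \<in> H_set n))"

lemma factorable_cong:
  assumes "E \<inter> W \<times> W = E' \<inter> W \<times> W"
  shows "factorable n E W \<longleftrightarrow> factorable n E' W"
  using assms unfolding factorable_def by auto

lemma factorable_mono: "factorable n E W \<Longrightarrow> E \<subseteq> E' \<Longrightarrow> factorable n E' W"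
  unfolding factorable_def by (meson Int_mono subset_refl subset_trans)

lemma factorable_Union:
  assumes "\<And>C. C \<in> \<C> \<Longrightarrow> factorable n E C" "pairwise disjnt \<C>"
  shows "factorable n E (\<Union>\<C>)"
proof -
  obtain F where F: "\<And>C. C \<in> \<C> \<Longrightarrow> F C \<subseteq> E \<inter> C \<times> C"
      "\<And>C. C \<in> \<C> \<Longrightarrow> sym (F C)" "\<And>C v. C \<in> \<C> \<Longrightarrow> v \<in> C \<Longrightarrow> card (F C `` {v}) \<in> H_set n"
    using assms(1) unfolding factorable_def by metis
  have "(\<Union>C\<in>\<C>. F C) `` {v} = F C `` {v}" if "C \<in> \<C>" "v \<in> C" for C v
    using F(1) assms(2) that by (fastforce simp: pairwise_def disjnt_iff)
  moreover have "sym (\<Union>C\<in>\<C>. F C)" using F(2) by (auto simp: sym_def)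
  ultimately show ?thesis
    unfolding factorable_def using F(1,3) by (intro exI[of _ "\<Union>C\<in>\<C>. F C"]) fastforce
qed

lemma factorable_Un:
  assumes "factorable n E X" "factorable n E Y" "X \<inter> Y = {}"
  shows "factorable n E (X \<union> Y)"
  using factorable_Union[of "{X, Y}" n E] assms by (auto simp: pairwise_def disjnt_def Int_commute)

section \<open>Bad components\<close>

text \<open>
  A component of even order does not count as bad even if it has no factor: where the Tutte
  condition is passed on to it, the criterion itself provides the factor.
\<close>

definition bad_components :: "nat \<Rightarrow> ('a \<times> 'a) set \<Rightarrow> 'a set \<Rightarrow> 'a set set" where
  "bad_components n E W = {C \<in> components E W. odd (card C) \<and> \<not> factorable n E C}"

lemma finite_bad_components: "finite W \<Longrightarrow> finite (bad_components n E W)"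
  by (auto simp: bad_components_def finite_components)

lemma bad_components_of_component:
  assumes "K \<in> components E X"
  shows "bad_components n E K = (if odd (card K) \<and> \<not> factorable n E K then {K} else {})"
proof -
  have "components E K = {K}" by (rule components_cut_connected[OF componentsD(2)[OF assms]])
  then show ?thesis unfolding bad_components_def by (auto simp only: split: if_splits)
qed

lemma bad_components_Un:
  assumes "sym E" "\<And>a b. a \<in> X \<Longrightarrow> b \<in> Y \<Longrightarrow> (a, b) \<notin> E"
  shows "bad_components n E (X \<union> Y) = bad_components n E X \<union> bad_components n E Y"
  using components_Un[OF assms] unfolding bad_components_def by blast

lemma card_bad_components_Un:
  assumes "sym E" "\<And>a b. a \<in> X \<Longrightarrow> b \<in> Y \<Longrightarrow> (a, b) \<notin> E" "X \<inter> Y = {}" "finite X" "finite Y"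
  shows "card (bad_components n E (X \<union> Y)) =
    card (bad_components n E X) + card (bad_components n E Y)"
proof -
  have "bad_components n E X \<inter> bad_components n E Y = {}"
    using assms(3) componentsD(1,3) unfolding bad_components_def by blast
  then show ?thesis
    using bad_components_Un[OF assms(1,2)] card_Un_disjoint finite_bad_components assms(4,5) by metis
qed

lemma card_bad_components_split:
  assumes fin: "finite X" and sym: "sym E" and K: "K \<in> components E X" and T: "T \<subseteq> K"
  shows "card (bad_components n E (X - T)) =
    card (bad_components n E (K - T)) + card (bad_components n E (X - K))"
proof -
  have "X - T = (K - T) \<union> (X - K)" using componentsD(1)[OF K] T by blast
  moreover have "(a, b) \<notin> E" if "a \<in> K - T" "b \<in> X - K" for a b
    using that componentsD(4)[OF K] by blast
  moreover have "finite (K - T)" "finite (X - K)"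
    using fin componentsD(1)[OF K] by (auto intro: finite_subset)
  ultimately show ?thesis using card_bad_components_Un[OF sym, of "K - T" "X - K" n] by auto
qed

text \<open>
  A change of the graph that only affects the vertices of \<open>A\<close> creates at most \<open>|A|\<close> new bad
  components, since a component avoiding \<open>A\<close> was already there, and each vertex of \<open>A\<close> lies in only
  one. It covers the deletion of an edge, the attachment of a pendant vertex and the removal of
  whole branches at a vertex.
\<close>

lemma card_bad_components_perturb:
  assumes fin: "finite X" "finite X'" "finite A"
    and vert: "X' - A \<subseteq> X"
    and out: "\<And>v w. v \<in> X' - A \<Longrightarrow> w \<in> X \<Longrightarrow> (v, w) \<in> E \<Longrightarrow> w \<in> X' \<and> (v, w) \<in> E'"
    and ins: "\<And>v w. v \<in> X' - A \<Longrightarrow> w \<in> X' - A \<Longrightarrow> (v, w) \<in> E' \<Longrightarrow> (v, w) \<in> E"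
  shows "card (bad_components n E' X') \<le> card (bad_components n E X) + card A"
proof -
  have "D \<in> bad_components n E X" if D: "D \<in> bad_components n E' X'" and DA: "D \<inter> A = {}" for D
  proof -
    have comp: "D \<in> components E' X'" using D unfolding bad_components_def by blast
    have sub: "D \<subseteq> X' - A" using componentsD(1)[OF comp] DA by blast
    have same: "E \<inter> D \<times> D = E' \<inter> D \<times> D" using sub vert out ins by blast
    have "D \<in> components E X"
      using cut_connected_cong[OF same] componentsD[OF comp] sub vert out
      unfolding components_def by blast
    then show ?thesis using D factorable_cong[OF same] unfolding bad_components_def by blast
  qed
  then have sub: "bad_components n E' X' \<subseteq>
      bad_components n E X \<union> {D \<in> components E' X'. D \<inter> A \<noteq> {}}" (is "_ \<subseteq> _ \<union> ?M")
    unfolding bad_components_def by blast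
  have "card ?M \<le> card A"
  proof -
    have ex: "\<forall>D\<in>?M. \<exists>a. a \<in> D \<inter> A" by blast
    obtain f where f: "\<And>D. D \<in> ?M \<Longrightarrow> f D \<in> D \<inter> A"
      using bchoice[OF ex] by blast
    have "inj_on f ?M"
    proof (rule inj_onI)
      fix C D assume "C \<in> ?M" "D \<in> ?M" "f C = f D"
      then show "C = D" using f[of C] f[of D] component_eqI[of C E' X' D "f C"] by simp
    qed
    then show ?thesis using f fin(3) by (intro card_inj_on_le[of f]) auto
  qed
  moreover have "finite ?M" using finite_components[OF fin(2)] by auto
  then have "card (bad_components n E' X') \<le> card (bad_components n E X \<union> ?M)"
    using sub finite_bad_components[OF fin(1)] by (intro card_mono) auto
  ultimately show ?thesis using card_Un_le[of "bad_components n E X" ?M] by linarith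
qed

text \<open>
  The easy direction of the criterion, in a form that tolerates edges of \<open>E'\<close> that have an end in
  \<open>S\<close>: a bad component without factor edges to \<open>S\<close> would inherit a factor, and the factor has at
  most \<open>2n|S|\<close> edges at \<open>S\<close>.
\<close>

lemma card_bad_components_le_of_factor:
  assumes n: "n \<ge> 1" and fin: "finite W" and sym: "sym E" and S: "S \<subseteq> W"
    and fact: "factorable n E' W" and same: "E' \<inter> (W - S) \<times> (W - S) \<subseteq> E"
  shows "card (bad_components n E (W - S)) \<le> 2 * n * card S"
proof -
  obtain F where F: "F \<subseteq> E' \<inter> W \<times> W" "sym F" "\<And>v. v \<in> W \<Longrightarrow> card (F `` {v}) \<in> H_set n"
    using fact unfolding factorable_def by blast
  have "\<exists>e. e \<in> F \<and> fst e \<in> S \<and> snd e \<in> C" if C: "C \<in> bad_components n E (W - S)" for C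
  proof (rule ccontr)
    assume no: "\<not> ?thesis"
    have comp: "C \<in> components E (W - S)" using C unfolding bad_components_def by blast
    have CW: "C \<subseteq> W - S" by (rule componentsD(1)[OF comp])
    have stay: "w \<in> C \<and> (v, w) \<in> E" if "v \<in> C" "(v, w) \<in> F" for v w
    proof -
      have "w \<notin> S" using no symD[OF F(2)] that by force
      then have "w \<in> W - S" "(v, w) \<in> E" using same F(1) that CW by blast+
      then show ?thesis using componentsD(4)[OF comp] that by blast
    qed
    have "(F \<inter> C \<times> C) `` {v} = F `` {v}" if "v \<in> C" for v using stay that by blast
    moreover have "F \<inter> C \<times> C \<subseteq> E \<inter> C \<times> C" using stay by blast
    moreover have "sym (F \<inter> C \<times> C)" using symD[OF F(2)] by (intro symI) blast
    ultimately have "factorable n E C"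
      unfolding factorable_def using F(3) CW by (intro exI[of _ "F \<inter> C \<times> C"]) auto
    then show False using C unfolding bad_components_def by blast
  qed
  then obtain g where g: "\<And>C. C \<in> bad_components n E (W - S) \<Longrightarrow> g C \<in> F \<and> fst (g C) \<in> S \<and> snd (g C) \<in> C"
    by metis
  have finS: "finite S" using S fin finite_subset by blast
  have finF: "finite (F `` {s})" for s
  proof -
    have "F `` {s} \<subseteq> W" using F(1) by blast
    then show ?thesis using fin by (rule finite_subset)
  qed
  have "inj_on g (bad_components n E (W - S))"
  proof (rule inj_onI)
    fix C D assume CD: "C \<in> bad_components n E (W - S)" "D \<in> bad_components n E (W - S)" "g C = g D"
    then show "C = D"
      using g[of C] g[of D] component_eqI[of C E "W - S" D "snd (g C)"]
      by (simp add: bad_components_def)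
  qed
  moreover have "g C \<in> (SIGMA s:S. F `` {s})" if "C \<in> bad_components n E (W - S)" for C
    using g[OF that] by (cases "g C") auto
  then have "g ` bad_components n E (W - S) \<subseteq> (SIGMA s:S. F `` {s})" by blast
  ultimately have "card (bad_components n E (W - S)) \<le> card (SIGMA s:S. F `` {s})"
    using finS finF by (intro card_inj_on_le[of g]) auto
  also have "\<dots> = (\<Sum>s\<in>S. card (F `` {s}))" using finS finF by simp
  also have "\<dots> \<le> card S * (2 * n)"
    using sum_bounded_above[of S "\<lambda>s. card (F `` {s})" "2 * n"] H_set_le F(3) S by auto
  finally show ?thesis by (simp add: mult.commute mult.left_commute)
qed

text \<open>
  The empty set is left out: for it the bound would say that no component of \<open>W\<close> is bad, which
  in the case of odd order is part of what is to be proved.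
\<close>

definition tutte_condition :: "nat \<Rightarrow> ('a \<times> 'a) set \<Rightarrow> 'a set \<Rightarrow> bool" where
  "tutte_condition n E W \<longleftrightarrow>
     (\<forall>S \<subseteq> W. S \<noteq> {} \<longrightarrow> card (bad_components n E (W - S)) \<le> 2 * n * card S)"

section \<open>Hall's theorem with capacities\<close>

text \<open>
  Hall's theorem, by the argument of Halmos and Vaughan: if some proper nonempty \<open>J\<close> is tight, \<open>J\<close>
  and the remaining indices are served separately; otherwise every proper nonempty subfamily has a spare
  representative, and an arbitrary choice for one index does no harm.
\<close>

lemma distinct_representatives:
  assumes "finite I" "\<And>i. i \<in> I \<Longrightarrow> finite (N i)"
    "\<And>J. J \<subseteq> I \<Longrightarrow> card J \<le> card (\<Union>i\<in>J. N i)"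
  shows "\<exists>f. inj_on f I \<and> (\<forall>i\<in>I. f i \<in> N i)"
  using assms
proof (induction "card I" arbitrary: I N rule: less_induct)
  case less
  note fin = less.prems(1,2) and hall = less.prems(3)
  show ?case
  proof (cases "\<exists>J\<subseteq>I. J \<noteq> {} \<and> J \<noteq> I \<and> card (\<Union>i\<in>J. N i) = card J")
    case True
    then obtain J where J: "J \<subseteq> I" "J \<noteq> {}" "J \<noteq> I" "card (\<Union>i\<in>J. N i) = card J" by blast
    have finJ: "finite J" using J fin(1) finite_subset by blast
    have "card J < card I" using J fin(1) by (intro psubset_card_mono) auto
    moreover have "finite (N i)" if "i \<in> J" for i using that J(1) fin(2) by blast
    moreover have "card K \<le> card (\<Union>i\<in>K. N i)" if "K \<subseteq> J" for K using that J(1) hall by blast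
    ultimately obtain f where f: "inj_on f J" "\<forall>i\<in>J. f i \<in> N i"
      using less.hyps[of J N] finJ by blast
    define M where "M i = N i - (\<Union>i\<in>J. N i)" for i
    have "card K \<le> card (\<Union>i\<in>K. M i)" if K: "K \<subseteq> I - J" for K
    proof -
      have finK: "finite K" using K fin(1) finite_subset by blast
      have eq: "(\<Union>i\<in>K \<union> J. N i) = (\<Union>i\<in>K. M i) \<union> (\<Union>i\<in>J. N i)" by (auto simp: M_def)
      have "card K + card J = card (K \<union> J)"
        using K finK finJ by (intro card_Un_disjoint[symmetric]) auto
      also have "\<dots> \<le> card (\<Union>i\<in>K \<union> J. N i)" using hall[of "K \<union> J"] K J(1) by blast
      also have "\<dots> \<le> card (\<Union>i\<in>K. M i) + card (\<Union>i\<in>J. N i)" unfolding eq by (rule card_Un_le)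
      finally show ?thesis using J(4) by simp
    qed
    moreover have "card (I - J) < card I" using J fin(1) by (intro psubset_card_mono) auto
    moreover have "finite (M i)" if "i \<in> I - J" for i using that fin(2) by (auto simp: M_def)
    ultimately obtain g where g: "inj_on g (I - J)" "\<forall>i\<in>I - J. g i \<in> M i"
      using less.hyps[of "I - J" M] fin(1) by auto
    have "inj_on (\<lambda>i. if i \<in> J then f i else g i) I"
    proof (rule inj_onI)
      fix i j
      assume ij: "i \<in> I" "j \<in> I" "(if i \<in> J then f i else g i) = (if j \<in> J then f j else g j)"
      have ne: "f i' \<noteq> g j'" if "i' \<in> J" "j' \<in> I - J" for i' j'
        using f(2) g(2) that unfolding M_def by fastforce
      show "i = j"
        using ij ne[of i j] ne[of j i] inj_onD[OF f(1), of i j] inj_onD[OF g(1), of i j]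
        by (cases "i \<in> J"; cases "j \<in> J") auto
    qed
    moreover have "\<forall>i\<in>I. (if i \<in> J then f i else g i) \<in> N i"
      using f(2) g(2) by (auto simp: M_def)
    ultimately show ?thesis by blast
  next
    case no_tight: False
    show ?thesis
    proof (cases "I = {}")
      case False
      then obtain i where i: "i \<in> I" by blast
      then have "N i \<noteq> {}" using hall[of "{i}"] by auto
      then obtain x where x: "x \<in> N i" by blast
      define M where "M j = N j - {x}" for j
      have "card K \<le> card (\<Union>j\<in>K. M j)" if K: "K \<subseteq> I - {i}" for K
      proof (cases "K = {}")
        case False
        have eq: "(\<Union>j\<in>K. M j) = (\<Union>j\<in>K. N j) - {x}" by (auto simp: M_def)
        have "K \<subseteq> I" "K \<noteq> I" using K i by auto
        then have "card K \<noteq> card (\<Union>j\<in>K. N j)" using no_tight False by metis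
        moreover have "card K \<le> card (\<Union>j\<in>K. N j)" using K by (intro hall) blast
        ultimately have "card K < card (\<Union>j\<in>K. N j)" by linarith
        then show ?thesis unfolding eq using diff_card_le_card_Diff[of "{x}" "\<Union>j\<in>K. N j"] by simp
      qed simp
      moreover have "card (I - {i}) < card I" by (rule card_Diff1_less[OF fin(1) i])
      moreover have "finite (M j)" if "j \<in> I - {i}" for j using that fin(2) by (auto simp: M_def)
      ultimately obtain g where g: "inj_on g (I - {i})" "\<forall>j\<in>I - {i}. g j \<in> M j"
        using less.hyps[of "I - {i}" M] fin(1) by auto
      have "inj_on (g(i := x)) I"
        using g unfolding M_def inj_on_def by (auto simp: fun_upd_def)
      moreover have "\<forall>j\<in>I. (g(i := x)) j \<in> N j" using g(2) x by (auto simp: M_def)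
      ultimately show ?thesis by blast
    qed simp
  qed
qed

text \<open>
  Splitting every element into \<open>c\<close> copies reduces the capacities to distinct representatives.
\<close>

lemma capacitated_assignment:
  assumes "finite I" "\<And>i. i \<in> I \<Longrightarrow> finite (N i)"
    and hall: "\<And>J. J \<subseteq> I \<Longrightarrow> card J \<le> c * card (\<Union>i\<in>J. N i)"
  shows "\<exists>f. (\<forall>i\<in>I. f i \<in> N i) \<and> (\<forall>s. card {i \<in> I. f i = s} \<le> c)"
proof -
  have "card J \<le> card (\<Union>i\<in>J. N i \<times> {..<c})" if "J \<subseteq> I" for J
  proof -
    have "(\<Union>i\<in>J. N i \<times> {..<c}) = (\<Union>i\<in>J. N i) \<times> {..<c}" by auto
    then show ?thesis using hall[OF that] by (simp add: card_cartesian_product mult.commute)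
  qed
  then obtain f where f: "inj_on f I" "\<forall>i\<in>I. f i \<in> N i \<times> {..<c}"
    using distinct_representatives[of I "\<lambda>i. N i \<times> {..<c}"] assms(1,2) by auto
  have "card {i \<in> I. fst (f i) = s} \<le> c" for s
  proof -
    have "inj_on (snd \<circ> f) {i \<in> I. fst (f i) = s}"
      using f(1) by (auto simp: inj_on_def prod_eq_iff)
    moreover have "(snd \<circ> f) ` {i \<in> I. fst (f i) = s} \<subseteq> {..<c}" using f(2) by auto
    ultimately show ?thesis using card_inj_on_le[of "snd \<circ> f" _ "{..<c}"] by simp
  qed
  then show ?thesis using f(2) by (intro exI[of _ "fst \<circ> f"]) (auto simp: mem_Times_iff)
qed

section \<open>Factors from assignments of bad components\<close>

text \<open>
  A factor of \<open>K\<close> with an additional edge from \<open>x \<in> K\<close> to an outside vertex \<open>s\<close>. The degree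
  condition is imposed on \<open>K\<close> only, because \<open>s\<close> will collect the edges of several components.
\<close>

definition pendant_factor :: "nat \<Rightarrow> ('a \<times> 'a) set \<Rightarrow> 'a set \<Rightarrow> 'a \<Rightarrow> 'a \<Rightarrow> ('a \<times> 'a) set \<Rightarrow> bool" where
  "pendant_factor n E K s x F \<longleftrightarrow> F \<subseteq> E \<inter> K \<times> K \<union> {(s, x), (x, s)} \<and> sym F \<and>
     (\<forall>v\<in>K. card (F `` {v}) \<in> H_set n) \<and> F `` {s} = {x}"

text \<open>
  If all bounds for \<open>K\<close> are strict, then \<open>K\<close> with the pendant edge \<open>sx\<close> still satisfies
  the Tutte condition, because one pendant vertex creates at most one bad component. The new graph
  has even order, so by induction it has a factor, which must use the only edge at \<open>s\<close>.
\<close>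

lemma pendant_factor_exists:
  assumes n: "n \<ge> 1" and fin: "finite K" and sym: "sym E" and conn: "cut_connected E K"
    and odd: "odd (card K)"
    and slack: "\<And>T. T \<subseteq> K \<Longrightarrow> T \<noteq> {} \<Longrightarrow> card (bad_components n E (K - T)) < 2 * n * card T"
    and x: "x \<in> K" and s: "s \<notin> K"
    and IH: "\<And>E'. sym E' \<Longrightarrow> cut_connected E' (insert s K) \<Longrightarrow> tutte_condition n E' (insert s K)
      \<Longrightarrow> factorable n E' (insert s K)"
  shows "\<exists>F. pendant_factor n E K s x F"
proof -
  define E' where "E' = E \<inter> K \<times> K \<union> {(s, x), (x, s)}"
  have symE': "sym E'" using symD[OF sym] unfolding E'_def by (intro symI) blast
  have connE': "cut_connected E' (insert s K)"
    unfolding cut_connected_def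
  proof (intro conjI allI impI)
    fix A assume A: "A \<subseteq> insert s K" "A \<noteq> {}" "A \<noteq> insert s K"
    show "\<exists>a\<in>A. \<exists>b\<in>insert s K - A. (a, b) \<in> E'"
    proof (cases "A \<inter> K = {} \<or> A \<inter> K = K")
      case True
      then have "A = {s} \<or> A = K" using A by blast
      then show ?thesis using x s by (auto simp: E'_def)
    next
      case False
      then obtain a b where "a \<in> A \<inter> K" "b \<in> K" "b \<notin> A \<inter> K" "(a, b) \<in> E"
        using cut_connectedE[OF conn, of "A \<inter> K"] by blast
      then show ?thesis by (auto simp: E'_def)
    qed
  qed simp
  have "tutte_condition n E' (insert s K)"
    unfolding tutte_condition_def
  proof (intro allI impI)
    fix T assume T: "T \<subseteq> insert s K" "T \<noteq> {}"
    show "card (bad_components n E' (insert s K - T)) \<le> 2 * n * card T"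
    \<comment> \<open>For \<open>T = {s}\<close> what remains is \<open>K\<close>, with one component; otherwise the strict bound for \<open>T \<inter> K\<close> applies.\<close>
    proof (cases "T \<inter> K = {}")
      case True
      then have "insert s K - T = K" and "T = {s}" using T s by auto
      moreover have "E' \<inter> K \<times> K = E \<inter> K \<times> K" using s by (auto simp: E'_def)
      then have "components E' K = {K}"
        using components_cut_connected cut_connected_cong conn by metis
      then have "card (bad_components n E' K) \<le> card {K}"
        by (intro card_mono) (auto simp: bad_components_def)
      ultimately show ?thesis using n by simp
    next
      case False
      have "card (bad_components n E' (insert s K - T)) \<le>
          card (bad_components n E (K - (T \<inter> K))) + card {s}"
        using fin s by (intro card_bad_components_perturb) (auto simp: E'_def)
      moreover have "card (T \<inter> K) \<le> card T"
        using T(1) fin by (intro card_mono) (auto intro: finite_subset)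
      then have "2 * n * card (T \<inter> K) \<le> 2 * n * card T" by (rule mult_le_mono2)
      moreover have "card {s} = 1" by simp
      ultimately show ?thesis using slack[OF Int_lower2 False] by linarith
    qed
  qed
  then have "factorable n E' (insert s K)" by (rule IH[OF symE' connE'])
  then obtain F where F: "F \<subseteq> E' \<inter> insert s K \<times> insert s K" "sym F"
      "\<forall>v\<in>insert s K. card (F `` {v}) \<in> H_set n"
    unfolding factorable_def by blast
  have "F `` {s} \<subseteq> {x}" using F(1) s by (auto simp: E'_def)
  moreover have "F `` {s} \<noteq> {}" using F(3) zero_notin_H_set[OF n] by force
  ultimately have "F `` {s} = {x}" by blast
  then have "pendant_factor n E K s x F"
    using F unfolding pendant_factor_def E'_def by blast
  then show ?thesis by blast
qed

text \<open>
  The pendant factors overlap only in \<open>S\<close>, where each contributes one edge, and edges of different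
  components have different ends. Hence the degree of \<open>s \<in> S\<close> is the number of components assigned
  to it.
\<close>

lemma factorable_of_assignment:
  assumes S: "S \<subseteq> W" and sym: "sym E"
    and disj: "pairwise disjnt \<C>" and \<C>: "\<And>C. C \<in> \<C> \<Longrightarrow> C \<subseteq> W - S"
    and pend: "\<And>C. C \<in> \<C> \<Longrightarrow> f C \<in> S \<and> x C \<in> C \<and> (f C, x C) \<in> E \<and> pendant_factor n E C (f C) (x C) (F C)"
    and deg: "\<And>s. s \<in> S \<Longrightarrow> card {C \<in> \<C>. f C = s} \<in> H_set n"
    and rest: "factorable n E (W - S - \<Union>\<C>)"
  shows "factorable n E W"
proof -
  obtain R where R: "R \<subseteq> E \<inter> (W - S - \<Union>\<C>) \<times> (W - S - \<Union>\<C>)" "sym R"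
      "\<And>v. v \<in> W - S - \<Union>\<C> \<Longrightarrow> card (R `` {v}) \<in> H_set n"
    using rest unfolding factorable_def by blast
  have F: "F C \<subseteq> E \<inter> C \<times> C \<union> {(f C, x C), (x C, f C)}" "sym (F C)" "F C `` {f C} = {x C}"
      "\<And>v. v \<in> C \<Longrightarrow> card (F C `` {v}) \<in> H_set n" if "C \<in> \<C>" for C
    using pend[OF that] unfolding pendant_factor_def by blast+
  define Q where "Q = (\<Union>C\<in>\<C>. F C) \<union> R"
  have same: "C = D" if "C \<in> \<C>" "D \<in> \<C>" "v \<in> C" "v \<in> D" for C D v
    using disj that by (auto simp: pairwise_def disjnt_iff)
  have FW: "F C \<subseteq> E \<inter> W \<times> W" if C: "C \<in> \<C>" for C
  proof -
    have "(x C, f C) \<in> E" using pend[OF C] symD[OF sym] by blast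
    then show ?thesis using F(1)[OF C] pend[OF C] \<C>[OF C] S by blast
  qed
  have "Q \<subseteq> E \<inter> W \<times> W" using FW R(1) unfolding Q_def by blast
  moreover have "sym Q" using F(2) R(2) unfolding Q_def sym_def by blast
  moreover have "card (Q `` {v}) \<in> H_set n" if v: "v \<in> W" for v
  proof -
    consider "v \<in> S" | C where "C \<in> \<C>" "v \<in> C" | "v \<in> W - S - \<Union>\<C>" using v by blast
    then show ?thesis
    proof cases
      case 1
      have "Q `` {v} = x ` {C \<in> \<C>. f C = v}"
      proof
        show "Q `` {v} \<subseteq> x ` {C \<in> \<C>. f C = v}"
        proof
          fix w assume "w \<in> Q `` {v}"
          then obtain C where C: "C \<in> \<C>" "(v, w) \<in> F C" using R(1) 1 unfolding Q_def by blast
          then have "v = f C" using F(1)[OF C(1)] \<C>[OF C(1)] 1 pend[OF C(1)] by blast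
          then show "w \<in> x ` {C \<in> \<C>. f C = v}" using F(3)[OF C(1)] C by blast
        qed
        show "x ` {C \<in> \<C>. f C = v} \<subseteq> Q `` {v}" using F(3) unfolding Q_def by blast
      qed
      moreover have "inj_on x {C \<in> \<C>. f C = v}"
      proof (rule inj_onI)
        fix C D assume "C \<in> {C \<in> \<C>. f C = v}" "D \<in> {C \<in> \<C>. f C = v}" "x C = x D"
        then show "C = D" using same[of C D "x C"] pend[of C] pend[of D] by simp
      qed
      ultimately show ?thesis using deg[OF 1] by (simp add: card_image)
    next
      case 2
      have "w \<in> F C `` {v}" if "(v, w) \<in> Q" for w
      proof -
        obtain D where D: "D \<in> \<C>" "(v, w) \<in> F D" using \<open>(v, w) \<in> Q\<close> R(1) 2 unfolding Q_def by blast
        then have "v \<in> D" using F(1)[OF D(1)] pend[OF D(1)] \<C>[OF 2(1)] 2(2) by blast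
        then show ?thesis using same[OF 2(1) D(1) 2(2)] D by blast
      qed
      then have "Q `` {v} = F C `` {v}" using 2(1) unfolding Q_def by blast
      then show ?thesis using F(4)[OF 2] by simp
    next
      case 3
      have "(v, w) \<notin> F C" if "C \<in> \<C>" for C w
        using F(1)[OF that] pend[OF that] 3 that by blast
      then have "Q `` {v} = R `` {v}" unfolding Q_def by blast
      then show ?thesis using R(3)[OF 3] by simp
    qed
  qed
  ultimately show ?thesis unfolding factorable_def by blast
qed

section \<open>The Tutte-type criterion\<close>

lemma finite_max_on:
  fixes g :: "'b \<Rightarrow> 'c::linorder"
  assumes "finite X" "X \<noteq> {}"
  obtains S where "S \<in> X" "\<And>T. T \<in> X \<Longrightarrow> g T \<le> g S"
proof -
  have "Max (g ` X) \<in> g ` X" using assms by (intro Max_in) auto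
  then obtain S where "S \<in> X" "g S = Max (g ` X)" by auto
  moreover have "g T \<le> Max (g ` X)" if "T \<in> X" for T using assms(1) that by (intro Max_ge) auto
  ultimately show thesis using that by metis
qed

text \<open>
  The case in which the bound is attained, or missed by one, for some nonempty set. Connectedness
  of \<open>W\<close> ensures that every family of bad components has a neighbour, so that the Tutte condition
  yields Hall's condition. The assumption \<open>IH\<close> is the criterion for smaller vertex sets.
\<close>

lemma factorable_of_near_tight:
  fixes W :: "'a set"
  assumes n: "n \<ge> 2" and fin: "finite W" and sym: "sym E" and conn: "cut_connected E W"
    and cond: "tutte_condition n E W"
    and tight: "S0 \<subseteq> W" "S0 \<noteq> {}" "2 * n * card S0 \<le> card (bad_components n E (W - S0)) + 1"
    and IH: "\<And>E' (K :: 'a set). card K < card W \<Longrightarrow> finite K \<Longrightarrow> sym E' \<Longrightarrow> cut_connected E' K \<Longrightarrow>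
      tutte_condition n E' K \<Longrightarrow>
      even (card K) \<or> (\<exists>T\<subseteq>K. T \<noteq> {} \<and> 2 * n * card T \<le> card (bad_components n E' (K - T)) + 1) \<Longrightarrow>
      factorable n E' K"
  shows "factorable n E W"
proof -
  \<comment> \<open>The excess of bad components over the bound; it is \<open>0\<close> or \<open>-1\<close> at its maximum.\<close>
  define d where "d T = int (card (bad_components n E (W - T))) - int (2 * n * card T)" for T
  define X where "X = {T. T \<subseteq> W \<and> T \<noteq> {}}"
  have finX: "finite X" using fin by (auto simp: X_def intro: finite_subset[of _ "Pow W"])
  have S0X: "S0 \<in> X" using tight by (auto simp: X_def)
  then obtain S1 where S1: "S1 \<in> X" "\<And>T. T \<in> X \<Longrightarrow> d T \<le> d S1"
    using finite_max_on[OF finX, of d] by blast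
  \<comment> \<open>Among the sets of maximal excess, a largest one: enlarging it must lower the excess.\<close>
  obtain S where S: "S \<in> {T \<in> X. d T = d S1}" "\<And>T. T \<in> {T \<in> X. d T = d S1} \<Longrightarrow> card T \<le> card S"
    using finite_max_on[of "{T \<in> X. d T = d S1}" card] finX S1(1) by auto
  have SW: "S \<subseteq> W" "S \<noteq> {}" using S(1) by (auto simp: X_def)
  have finS: "finite S" using SW fin finite_subset by blast
  have beyond: "d (S \<union> T) < d S" if T: "T \<subseteq> W - S" "T \<noteq> {}" for T
  proof -
    have SX: "S \<union> T \<in> X" using SW T by (auto simp: X_def)
    have "finite (S \<union> T)" using SX fin finite_subset unfolding X_def by blast
    then have "card S < card (S \<union> T)" using T by (intro psubset_card_mono) auto
    then have "d (S \<union> T) \<noteq> d S1" using S(2)[of "S \<union> T"] SX by auto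
    then show ?thesis using S1(2)[OF SX] S(1) by simp
  qed
  define \<C> where "\<C> = bad_components n E (W - S)"
  have \<C>: "C \<in> components E (W - S)" "odd (card C)" "\<not> factorable n E C" if "C \<in> \<C>" for C
    using that unfolding \<C>_def bad_components_def by auto
  have fin\<C>: "finite \<C>" using fin finite_bad_components unfolding \<C>_def by blast
  have "d S0 \<le> d S" using S1(2)[OF S0X] S(1) by simp
  then have many: "2 * n * card S \<le> card \<C> + 1" using tight(3) unfolding d_def \<C>_def by linarith
  \<comment> \<open>Enlarging \<open>S\<close> by \<open>T \<subseteq> K\<close> changes only the contribution of \<open>K\<close>.\<close>
  have inside: "card (bad_components n E (K - T)) < 2 * n * card T + card (bad_components n E K)"
    if K: "K \<in> components E (W - S)" and T: "T \<subseteq> K" "T \<noteq> {}" for K T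
  proof -
    have KW: "K \<subseteq> W - S" by (rule componentsD(1)[OF K])
    have TW: "T \<subseteq> W - S" using KW T(1) by blast
    have fins: "finite (W - S)" "finite T" using fin TW finite_subset by auto
    have "card (bad_components n E (W - S - T)) =
        card (bad_components n E (K - T)) + card (bad_components n E (W - S - K))"
      by (rule card_bad_components_split[OF fins(1) sym K T(1)])
    moreover have "card (bad_components n E (W - S)) =
        card (bad_components n E K) + card (bad_components n E (W - S - K))"
      using card_bad_components_split[OF fins(1) sym K, of "{}"] by simp
    moreover have "card (S \<union> T) = card S + card T"
      using finS fins TW by (intro card_Un_disjoint) auto
    moreover have "W - (S \<union> T) = W - S - T" by blast
    ultimately have "int (card (bad_components n E (K - T))) <
        int (2 * n * card T + card (bad_components n E K))"
      using beyond[OF TW T(2)] unfolding d_def by (simp add: distrib_left)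
    then show ?thesis by (simp only: of_nat_less_iff)
  qed
  have smaller: "card K < card W" "finite K" if "K \<in> components E (W - S)" for K
  proof -
    have "K \<subset> W" using componentsD(1)[OF that] SW by blast
    then show "card K < card W" "finite K" using fin psubset_card_mono finite_subset by blast+
  qed
  have good: "factorable n E K" if K: "K \<in> components E (W - S)" "K \<notin> \<C>" for K
  proof (cases "even (card K)")
    case True
    have "tutte_condition n E K"
      using inside[OF K(1)] True bad_components_of_component[OF K(1), of n]
      unfolding tutte_condition_def by (auto intro: less_imp_le)
    then show ?thesis using IH[OF smaller[OF K(1)] sym componentsD(2)[OF K(1)]] True by simp
  next
    case False
    then show ?thesis using K unfolding \<C>_def bad_components_def by blast
  qed
  have "\<Union> (components E (W - S)) = W - S" by (rule Union_components[OF finite_Diff[OF fin] sym])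
  then have "W - S - \<Union>\<C> = \<Union> (components E (W - S) - \<C>)"
    using Union_components_Diff[of \<C> E "W - S"] \<C>(1) by auto
  moreover have "factorable n E (\<Union> (components E (W - S) - \<C>))"
    using good by (intro factorable_Union pairwise_subset[OF components_disjoint Diff_subset]) auto
  ultimately have rest: "factorable n E (W - S - \<Union>\<C>)" by simp
  \<comment> \<open>If a bad component had a set within one of its bound, \<open>IH\<close> would give it a factor.\<close>
  have slack: "card (bad_components n E (K - T)) < 2 * n * card T"
    if K: "K \<in> \<C>" and T: "T \<subseteq> K" "T \<noteq> {}" for K T
  proof (rule ccontr)
    assume *: "\<not> ?thesis"
    have "card (bad_components n E K) = 1"
      using bad_components_of_component[OF \<C>(1)[OF K], of n] \<C>(2,3)[OF K] by simp
    then have "card (bad_components n E (K - T)) \<le> 2 * n * card T" if "T \<subseteq> K" "T \<noteq> {}" for T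
      using inside[OF \<C>(1)[OF K] that] by linarith
    then have "tutte_condition n E K" unfolding tutte_condition_def by blast
    moreover have "\<exists>T\<subseteq>K. T \<noteq> {} \<and> 2 * n * card T \<le> card (bad_components n E (K - T)) + 1"
      using * T by (intro exI[of _ T]) auto
    ultimately have "factorable n E K"
      by (intro IH[OF smaller[OF \<C>(1)[OF K]] sym componentsD(2)[OF \<C>(1)[OF K]]] disjI2)
    then show False using \<C>(3)[OF K] by blast
  qed
  have pendant: "\<exists>F. pendant_factor n E K s x F" if K: "K \<in> \<C>" and "x \<in> K" "s \<in> S" for K s x
  proof -
    have KW: "K \<subseteq> W - S" by (rule componentsD(1)[OF \<C>(1)[OF K]])
    have finK: "finite K" by (rule smaller(2)[OF \<C>(1)[OF K]])
    \<comment> \<open>As \<open>2n|S| - 1 \<ge> 3\<close>, there is a second bad component \<open>C\<close>, so \<open>insert s K\<close> is smaller than \<open>W\<close>.\<close>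
    have "card S \<ge> 1" using SW finS by (simp add: Suc_le_eq card_gt_0_iff)
    then have "2 * 2 * 1 \<le> 2 * n * card S" using n by (intro mult_le_mono) auto
    then have "\<not> \<C> \<subseteq> {K}" using many card_mono[of "{K}" \<C>] by auto
    then obtain C where C: "C \<in> \<C>" "C \<noteq> K" by blast
    then obtain y where y: "y \<in> C" using componentsD(3)[OF \<C>(1)] by blast
    have "y \<in> W - S" "y \<notin> K"
      using y C componentsD(1)[OF \<C>(1)[OF C(1)]] component_eqI[OF \<C>(1)[OF C(1)] \<C>(1)[OF K]] by blast+
    then have "insert s K \<subset> W" using KW SW \<open>s \<in> S\<close> by blast
    then have less: "card (insert s K) < card W" using fin by (rule psubset_card_mono[rotated])
    have s: "s \<notin> K" using KW \<open>s \<in> S\<close> by blast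
    show ?thesis
    proof (rule pendant_factor_exists[OF _ finK sym componentsD(2)[OF \<C>(1)[OF K]] \<C>(2)[OF K]
          slack[OF K] \<open>x \<in> K\<close> s])
      fix E' assume "sym E'" "cut_connected E' (insert s K)" "tutte_condition n E' (insert s K)"
      moreover have "even (card (insert s K))" using finK s \<C>(2)[OF K] by simp
      ultimately show "factorable n E' (insert s K)" using IH[OF less] finK by blast
    qed (use n in auto)
  qed
  define N where "N C = {s \<in> S. \<exists>x\<in>C. (s, x) \<in> E}" for C
  have "card J \<le> (2 * n) * card (\<Union>C\<in>J. N C)" if J: "J \<subseteq> \<C>" for J
  proof (cases "J = {}")
    case False
    \<comment> \<open>The members of \<open>J\<close> remain bad components when only their neighbours \<open>U\<close> are deleted.\<close>
    define U where "U = (\<Union>C\<in>J. N C)"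
    have US: "U \<subseteq> S" by (auto simp: U_def N_def)
    obtain C where C: "C \<in> J" using False by blast
    then have comp: "C \<in> components E (W - S)" using J \<C>(1) by blast
    have "C \<noteq> W" using componentsD(1)[OF comp] SW by blast
    then obtain a b where ab: "a \<in> C" "b \<in> W" "b \<notin> C" "(a, b) \<in> E"
      using cut_connectedE[OF conn _ componentsD(3)[OF comp]] componentsD(1)[OF comp] by blast
    then have "b \<in> S" using componentsD(4)[OF comp] by blast
    then have "b \<in> U" using ab symD[OF sym] C unfolding U_def N_def by blast
    then have U: "U \<subseteq> W" "U \<noteq> {}" using US SW by blast+
    have "D \<in> bad_components n E (W - U)" if D: "D \<in> J" for D
    proof -
      have comp: "D \<in> components E (W - S)" and D\<C>: "D \<in> \<C>" using D J \<C>(1) by blast+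
      have "(a, b) \<notin> E" if "a \<in> D" "b \<in> W - U - D" for a b
      proof
        assume ab: "(a, b) \<in> E"
        then have "b \<in> S" using that componentsD(4)[OF comp] by blast
        then have "b \<in> N D" using symD[OF sym ab] that(1) unfolding N_def by blast
        then show False using that(2) D unfolding U_def by blast
      qed
      then have "D \<in> components E (W - U)"
        using componentsD(1,2)[OF comp] US unfolding components_def by blast
      then show ?thesis using \<C>(2,3)[OF D\<C>] unfolding bad_components_def by blast
    qed
    then have "card J \<le> card (bad_components n E (W - U))"
      using fin by (intro card_mono finite_bad_components) auto
    also have "\<dots> \<le> 2 * n * card U" using cond U unfolding tutte_condition_def by blast
    finally show ?thesis unfolding U_def .
  qed simp
  moreover have "finite (N C)" for C using finS by (auto simp: N_def)
  ultimately have "\<exists>f. (\<forall>C\<in>\<C>. f C \<in> N C) \<and> (\<forall>s. card {C \<in> \<C>. f C = s} \<le> 2 * n)"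
    by (intro capacitated_assignment[OF fin\<C>])
  then obtain f where f: "\<And>C. C \<in> \<C> \<Longrightarrow> f C \<in> N C" "\<And>s. card {C \<in> \<C>. f C = s} \<le> 2 * n"
    by blast
  have "\<forall>C\<in>\<C>. \<exists>x. x \<in> C \<and> (f C, x) \<in> E" using f(1) unfolding N_def by blast
  then obtain x where x: "\<And>C. C \<in> \<C> \<Longrightarrow> x C \<in> C \<and> (f C, x C) \<in> E" by metis
  have fS: "f C \<in> S" if "C \<in> \<C>" for C using f(1)[OF that] by (simp add: N_def)
  have "\<forall>C\<in>\<C>. \<exists>F. pendant_factor n E C (f C) (x C) F" using pendant x fS by blast
  then obtain F where F: "\<And>C. C \<in> \<C> \<Longrightarrow> pendant_factor n E C (f C) (x C) (F C)" by metis
  \<comment> \<open>If one vertex of \<open>S\<close> had at most \<open>2n - 2\<close> components, fewer than \<open>2n|S| - 1\<close> would be assigned.\<close>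
  have deg: "card {C \<in> \<C>. f C = s} \<in> H_set n" if s: "s \<in> S" for s
  proof -
    have "f ` \<C> \<subseteq> S" using fS by blast
    then have "card \<C> = (\<Sum>s\<in>S. card {C \<in> \<C>. f C = s})"
      using sum.group[OF fin\<C> finS, of f "\<lambda>_. 1::nat"] by simp
    also have "\<dots> = card {C \<in> \<C>. f C = s} + (\<Sum>s\<in>S - {s}. card {C \<in> \<C>. f C = s})"
      by (rule sum.remove[OF finS s])
    also have "(\<Sum>s\<in>S - {s}. card {C \<in> \<C>. f C = s}) \<le> card (S - {s}) * (2 * n)"
      using sum_bounded_above[of "S - {s}" _ "2 * n"] f(2) by simp
    finally have le: "card \<C> \<le> card {C \<in> \<C>. f C = s} + card (S - {s}) * (2 * n)" by simp
    have "card S = Suc (card (S - {s}))" using finS s by (rule card.remove)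
    then have "2 * n * card S = 2 * n + card (S - {s}) * (2 * n)" by simp
    then have "2 * n \<le> card {C \<in> \<C>. f C = s} + 1" using many le by linarith
    then have "card {C \<in> \<C>. f C = s} = 2 * n - 1 \<or> card {C \<in> \<C>. f C = s} = 2 * n"
      using f(2)[of s] by linarith
    then show ?thesis using n by (auto simp: H_set_def)
  qed
  have "pairwise disjnt \<C>"
    using pairwise_subset[OF components_disjoint] \<C>(1) by blast
  moreover have "C \<subseteq> W - S" if "C \<in> \<C>" for C using componentsD(1)[OF \<C>(1)[OF that]] .
  ultimately show ?thesis
    using fS x F by (intro factorable_of_assignment[OF SW(1) sym _ _ _ deg rest, of x F]) simp_all
qed

text \<open>
  The case in which the bound is missed by at least two for all nonempty sets. The slack of two pays
  for deleting an edge (two new bad components at most) and for passing to a part that hangs on a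
  single vertex (one at most). The assumption \<open>IH\<close> is the criterion for smaller vertex sets,
  \<open>IHE\<close> is the criterion after deletion of an edge.
\<close>

lemma factorable_of_slack:
  fixes W :: "'a set"
  assumes n: "n \<ge> 2" and fin: "finite W" and sym: "sym E" and conn: "cut_connected E W"
    and even: "even (card W)"
    and slack: "\<And>S. S \<subseteq> W \<Longrightarrow> S \<noteq> {} \<Longrightarrow> card (bad_components n E (W - S)) + 2 \<le> 2 * n * card S"
    and IH: "\<And>K :: 'a set. card K < card W \<Longrightarrow> finite K \<Longrightarrow> cut_connected E K \<Longrightarrow>
      tutte_condition n E K \<Longrightarrow> even (card K) \<Longrightarrow> factorable n E K"
    and IHE: "\<And>a b. a \<in> W \<Longrightarrow> b \<in> W \<Longrightarrow> (a, b) \<in> E \<Longrightarrow> cut_connected (E - {(a, b), (b, a)}) W \<Longrightarrow>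
      tutte_condition n (E - {(a, b), (b, a)}) W \<Longrightarrow> factorable n (E - {(a, b), (b, a)}) W"
  shows "factorable n E W"
proof (rule ccontr)
  assume not: "\<not> factorable n E W"
  \<comment> \<open>A proper part of even order that hangs on a single vertex \<open>c\<close> is factorable by induction.\<close>
  have gate: "factorable n E Q"
    if Q: "Q \<subseteq> W" "Q \<noteq> W" "c \<in> Q" "even (card Q)"
      and only: "\<And>v w. v \<in> Q \<Longrightarrow> w \<in> W - Q \<Longrightarrow> (v, w) \<in> E \<Longrightarrow> v = c" for Q c
  proof -
    have finQ: "finite Q" using Q(1) fin finite_subset by blast
    have "card (bad_components n E (Q - T)) \<le> 2 * n * card T" if T: "T \<subseteq> Q" "T \<noteq> {}" for T
    proof -
      have "card (bad_components n E (Q - T)) \<le> card (bad_components n E (W - T)) + card {c}"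
      proof (rule card_bad_components_perturb)
        show "w \<in> Q - T \<and> (v, w) \<in> E" if "v \<in> Q - T - {c}" "w \<in> W - T" "(v, w) \<in> E" for v w
          using only[of v w] that by blast
      qed (use fin finQ Q(1) in auto)
      moreover have "card (bad_components n E (W - T)) + 2 \<le> 2 * n * card T"
        using T Q(1) by (intro slack) auto
      ultimately show ?thesis by simp
    qed
    then have "tutte_condition n E Q" unfolding tutte_condition_def by blast
    moreover have "cut_connected E Q" by (rule cut_connected_of_gate[OF sym conn Q(1,3) only])
    moreover have "card Q < card W" using Q(1,2) fin by (intro psubset_card_mono) auto
    ultimately show ?thesis using IH finQ Q(4) by blast
  qed
  have bridge: "\<not> cut_connected (E - {(a, b), (b, a)}) W" if ab: "a \<in> W" "b \<in> W" "(a, b) \<in> E" for a b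
  proof
    assume conn': "cut_connected (E - {(a, b), (b, a)}) W"
    have "card (bad_components n (E - {(a, b), (b, a)}) (W - T)) \<le> 2 * n * card T"
      if T: "T \<subseteq> W" "T \<noteq> {}" for T
    proof -
      have "card (bad_components n (E - {(a, b), (b, a)}) (W - T)) \<le>
          card (bad_components n E (W - T)) + card {a, b}"
        using fin by (intro card_bad_components_perturb) auto
      moreover have "card {a, b} \<le> 2" by (simp add: card_insert_if)
      ultimately show ?thesis using slack[OF T] by linarith
    qed
    then have "tutte_condition n (E - {(a, b), (b, a)}) W" unfolding tutte_condition_def by blast
    then have "factorable n (E - {(a, b), (b, a)}) W" by (rule IHE[OF ab conn'])
    then show False using not factorable_mono Diff_subset by blast
  qed
  \<comment> \<open>Each neighbour \<open>y\<close> of \<open>x\<close> therefore lies in a component of \<open>W - {x}\<close> of its own, of odd order.\<close>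
  have branch: "\<exists>Q. Q \<in> components E (W - {x}) \<and> odd (card Q) \<and> y \<in> Q \<and> (\<forall>z\<in>Q. (x, z) \<in> E \<longrightarrow> z = y)"
    if xy: "x \<in> W" "y \<in> W" "(x, y) \<in> E" for x y
  proof -
    obtain P where P: "P \<subseteq> W" "x \<in> P" "y \<in> W - P"
        and only: "\<And>v w. v \<in> P \<Longrightarrow> w \<in> W - P \<Longrightarrow> (v, w) \<in> E \<Longrightarrow> v = x \<and> w = y"
      using bridge_split[OF sym conn bridge[OF xy]] by blast
    have only': "v = y \<and> w = x" if "v \<in> W - P" "w \<in> P" "(v, w) \<in> E" for v w
      using only[of w v] symD[OF sym] that by blast
    have card: "card P + card (W - P) = card W"
      using P(1) fin by (metis card_Diff_subset card_mono finite_subset le_add_diff_inverse)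
    have "odd (card (W - P))"
    proof
      assume ev: "even (card (W - P))"
      then have evP: "even (card P)" using card even by (metis even_add)
      have "factorable n E P"
        using gate[of P x] P evP only by blast
      moreover have "factorable n E (W - P)"
        using gate[of "W - P" y] P ev only' by blast
      ultimately have "factorable n E (P \<union> (W - P))" by (intro factorable_Un) auto
      then show False using not P(1) by (simp add: Un_absorb1)
    qed
    moreover have "cut_connected E (W - P)"
      using P only' by (intro cut_connected_of_gate[OF sym conn, of _ y]) blast+
    then have "W - P \<in> components E (W - {x})"
      using P only' unfolding components_def by blast
    moreover have "z = y" if "z \<in> W - P" "(x, z) \<in> E" for z using only[OF P(2)] that by blast
    ultimately show ?thesis using P(3) by blast
  qed
  \<comment> \<open>The whole edge set is not a factor, so some degree is wrong.\<close>
  have "\<exists>x\<in>W. card ((E \<inter> W \<times> W) `` {x}) \<notin> H_set n"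
  proof (rule ccontr)
    assume "\<not> ?thesis"
    moreover have "sym (E \<inter> W \<times> W)" using symD[OF sym] by (intro symI) blast
    ultimately have "factorable n E W" unfolding factorable_def by blast
    then show False using not by blast
  qed
  then obtain x where x: "x \<in> W" "card ((E \<inter> W \<times> W) `` {x}) \<notin> H_set n" by blast
  define Nx where "Nx = (E \<inter> W \<times> W) `` {x}"
  have Nx: "y \<in> W" "(x, y) \<in> E" if "y \<in> Nx" for y using that by (auto simp: Nx_def)
  have "\<forall>y\<in>Nx. \<exists>Q. Q \<in> components E (W - {x}) \<and> odd (card Q) \<and> y \<in> Q \<and> (\<forall>z\<in>Q. (x, z) \<in> E \<longrightarrow> z = y)"
    using branch[OF x(1)] Nx by blast
  then obtain Q where Q: "\<And>y. y \<in> Nx \<Longrightarrow> Q y \<in> components E (W - {x})"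
      "\<And>y. y \<in> Nx \<Longrightarrow> odd (card (Q y))" "\<And>y. y \<in> Nx \<Longrightarrow> y \<in> Q y"
      "\<And>y z. y \<in> Nx \<Longrightarrow> z \<in> Q y \<Longrightarrow> (x, z) \<in> E \<Longrightarrow> z = y"
    by metis
  have "D \<in> Q ` Nx" if D: "D \<in> components E (W - {x})" for D
  proof -
    have DW: "D \<subseteq> W - {x}" by (rule componentsD(1)[OF D])
    then have "D \<subseteq> W" "D \<noteq> W" using x(1) by blast+
    then obtain a b where ab: "a \<in> D" "b \<in> W" "b \<notin> D" "(a, b) \<in> E"
      using cut_connectedE[OF conn _ componentsD(3)[OF D]] by blast
    then have "b = x" using componentsD(4)[OF D] by blast
    then have "a \<in> Nx" using ab DW symD[OF sym] x(1) by (auto simp: Nx_def)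
    then have "D = Q a" using component_eqI[OF D Q(1)] ab(1) Q(3) by blast
    then show ?thesis using \<open>a \<in> Nx\<close> by blast
  qed
  then have comps: "components E (W - {x}) = Q ` Nx" using Q(1) by blast
  have "inj_on Q Nx"
  proof (rule inj_onI)
    fix y z assume "y \<in> Nx" "z \<in> Nx" "Q y = Q z"
    then show "y = z" using Q(3,4) Nx(2) by metis
  qed
  \<comment> \<open>Neighbours of \<open>x\<close> and components of \<open>W - {x}\<close> correspond, and \<open>|W| - 1\<close> is odd, so the degree is odd.\<close>
  then have deg: "card (components E (W - {x})) = card Nx" using comps card_image by metis
  have oddD: "odd (card D)" if "D \<in> components E (W - {x})" for D
    using that[unfolded comps] Q(2) by blast
  have "odd (card (W - {x}))" using even card.remove[OF fin x(1)] by simp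
  then have "odd (card (components E (W - {x})))"
    by (intro odd_card_of_odd_components[OF finite_Diff[OF fin] sym oddD])
  then have "odd (card Nx)" unfolding deg .
  moreover from this have "\<not> card Nx \<le> 2 * n - 1"
    using x(2) by (auto simp: Nx_def H_set_def)
  moreover from \<open>odd (card Nx)\<close> have "card Nx \<noteq> 2 * n" by auto
  ultimately have big: "card Nx \<ge> 2 * n + 1" by linarith
  define G where "G = components E (W - {x}) - bad_components n E (W - {x})"
  have good: "factorable n E C" if "C \<in> G" for C
    using that oddD[of C] by (simp add: G_def bad_components_def)
  have "card (components E (W - {x})) - card (bad_components n E (W - {x})) \<le> card G"
    unfolding G_def using finite_bad_components[OF finite_Diff[OF fin]] by (rule diff_card_le_card_Diff)
  moreover have "card (bad_components n E (W - {x})) + 2 \<le> 2 * n"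
    using slack[of "{x}"] x(1) by simp
  ultimately have "card G \<ge> 2" using big deg by linarith
  \<comment> \<open>Two components suffice: an even number has to be removed to keep the order of the rest even.\<close>
  then obtain G' where "G' \<subseteq> G" "card G' = 2" by (rule obtain_subset_with_card_n)
  then obtain C1 C2 where C: "C1 \<in> G" "C2 \<in> G" "C1 \<noteq> C2" by (auto simp: card_2_iff)
  then have comp: "C1 \<in> components E (W - {x})" "C2 \<in> components E (W - {x})" by (auto simp: G_def)
  have disj: "C1 \<inter> C2 = {}" using C(3) component_eqI[OF comp] by blast
  have sub: "C1 \<subseteq> W - {x}" "C2 \<subseteq> W - {x}" using componentsD(1)[OF comp(1)] componentsD(1)[OF comp(2)] .
  define W' where "W' = W - (C1 \<union> C2)"
  have finC: "finite C1" "finite C2" using sub fin finite_subset by blast+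
  have cardC: "card (C1 \<union> C2) = card C1 + card C2" using finC disj by (rule card_Un_disjoint)
  have W: "W' \<union> (C1 \<union> C2) = W" using sub by (auto simp: W'_def)
  have "card (W' \<union> (C1 \<union> C2)) = card W' + card (C1 \<union> C2)"
    using fin finC by (intro card_Un_disjoint) (auto simp: W'_def)
  then have "card W = card W' + (card C1 + card C2)" unfolding W cardC .
  then have "even (card W')" using even oddD[OF comp(1)] oddD[OF comp(2)] by simp
  moreover have "W' \<noteq> W" using componentsD(3)[OF comp(1)] sub by (auto simp: W'_def)
  moreover have "v = x" if "v \<in> W'" "w \<in> W - W'" "(v, w) \<in> E" for v w
  proof (rule ccontr)
    assume "v \<noteq> x"
    then have "v \<in> W - {x}" using that by (auto simp: W'_def)
    moreover have "(w, v) \<in> E" using symD[OF sym] that by blast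
    moreover have "w \<in> C1 \<union> C2" using that by (auto simp: W'_def)
    ultimately have "v \<in> C1 \<union> C2" using componentsD(4)[OF comp(1)] componentsD(4)[OF comp(2)] by blast
    then show False using that by (auto simp: W'_def)
  qed
  ultimately have "factorable n E W'"
    using gate[of W' x] x(1) sub unfolding W'_def by blast
  moreover have "factorable n E (C1 \<union> C2)" using good C disj by (intro factorable_Un) auto
  ultimately have "factorable n E (W' \<union> (C1 \<union> C2))"
    by (rule factorable_Un) (auto simp: W'_def)
  then show False using not unfolding W by blast
qed

text \<open>
  The converse direction of the criterion. The second alternative, which also covers odd orders, is
  what makes the induction work: applied to a bad component, it shows that there all bounds are
  strict.
\<close>

theorem factorable_of_tutte_condition:
  fixes W :: "'a set"
  assumes "n \<ge> 2" "finite W" "sym E" "cut_connected E W" "tutte_condition n E W"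
    "even (card W) \<or>
      (\<exists>S\<subseteq>W. S \<noteq> {} \<and> 2 * n * card S \<le> card (bad_components n E (W - S)) + 1)"
  shows "factorable n E W"
  using assms(2-)
proof (induction "card W" arbitrary: W E rule: less_induct)
  case less
  note smaller = less.hyps
  show ?case using less.prems
  proof (induction "card (E \<inter> W \<times> W)" arbitrary: E rule: less_induct)
    case (less E)
    note fin = less.prems(1) and sym = less.prems(2) and conn = less.prems(3) and cond = less.prems(4)
    show ?case
    proof (cases "\<exists>S\<subseteq>W. S \<noteq> {} \<and> 2 * n * card S \<le> card (bad_components n E (W - S)) + 1")
      case True
      then obtain S where "S \<subseteq> W" "S \<noteq> {}" "2 * n * card S \<le> card (bad_components n E (W - S)) + 1"
        by blast
      then show ?thesis
        using smaller by (rule factorable_of_near_tight[OF assms(1) fin sym conn cond])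
    next
      case False
      then have even: "even (card W)" using less.prems(5) by blast
      show ?thesis
      proof (rule factorable_of_slack[OF assms(1) fin sym conn even])
        show "card (bad_components n E (W - S)) + 2 \<le> 2 * n * card S" if "S \<subseteq> W" "S \<noteq> {}" for S
        proof -
          have "\<not> 2 * n * card S \<le> card (bad_components n E (W - S)) + 1"
            using False that by blast
          then show ?thesis by linarith
        qed
        show "factorable n E K" if "card K < card W" "finite K" "cut_connected E K"
          "tutte_condition n E K" "even (card K)" for K :: "'a set"
          using that(5) by (intro smaller[OF that(1,2) sym that(3,4)] disjI1)
      next
        fix a b
        assume ab: "a \<in> W" "b \<in> W" "(a, b) \<in> E"
          and "cut_connected (E - {(a, b), (b, a)}) W" "tutte_condition n (E - {(a, b), (b, a)}) W"
        moreover have "finite (E \<inter> W \<times> W)" using fin by simp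
        then have "card ((E - {(a, b), (b, a)}) \<inter> W \<times> W) < card (E \<inter> W \<times> W)"
          using ab by (intro psubset_card_mono) auto
        moreover have "sym (E - {(a, b), (b, a)})" using symD[OF sym] by (intro symI) blast
        ultimately show "factorable n (E - {(a, b), (b, a)}) W"
          using less.hyps fin even by blast
      qed
    qed
  qed
qed

section \<open>Graphs as symmetric arc sets\<close>

lemma neighbors_Image: "neighbors G v = parcs G `` {v}"
  by (auto simp: neighbors_def)

lemma pair_graphI:
  assumes "finite (pverts G)" "parcs G \<subseteq> pverts G \<times> pverts G" "sym (parcs G)" "\<And>v. (v, v) \<notin> parcs G"
  shows "pair_graph G"
proof unfold_locales
  show "finite (parcs G)" using assms(1,2) finite_subset by blast
  show "symmetric (with_proj G)" using assms(3) by (simp add: symmetric_def)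
qed (use assms in auto)

lemma pair_graphD:
  assumes "pair_graph G"
  shows "finite (pverts G)" "parcs G \<subseteq> pverts G \<times> pverts G" "sym (parcs G)" "\<And>v. (v, v) \<notin> parcs G"
proof -
  interpret pair_graph G by fact
  show "finite (pverts G)" by (rule pair_finite_verts)
  show "parcs G \<subseteq> pverts G \<times> pverts G"
    using arc_fst_in_verts arc_snd_in_verts by fastforce
  show "sym (parcs G)" using pair_sym_arcs by (simp add: symmetric_def)
  show "(v, v) \<notin> parcs G" for v using pair_no_loops by force
qed

lemma pair_graph_add_edge:
  assumes "pair_graph G" "u \<in> pverts G" "v \<in> pverts G" "u \<noteq> v"
  shows "pair_graph (add_edge G u v)"
proof (rule pair_graphI)
  show "sym (parcs (add_edge G u v))"
    using symD[OF pair_graphD(3)[OF assms(1)]] by (intro symI) (auto simp: add_edge_def)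
qed (use pair_graphD[OF assms(1)] assms(2-4) in \<open>auto simp: add_edge_def\<close>)

lemma out_degree_with_proj: "out_degree (with_proj F) v = card (parcs F `` {v})"
proof -
  have "out_arcs (with_proj F) v = Pair v ` (parcs F `` {v})" by (auto simp: out_arcs_def)
  then show ?thesis by (simp add: out_degree_def card_image inj_on_def)
qed

lemma has_H_factor_iff_factorable:
  assumes G: "pair_graph G"
  shows "has_H_factor n G \<longleftrightarrow> factorable n (parcs G) (pverts G)"
proof
  assume "has_H_factor n G"
  then obtain F where F: "pair_graph F" "spanning (with_proj F) (with_proj G)"
      "\<forall>v\<in>pverts G. out_degree (with_proj F) v \<in> H_set n"
    unfolding has_H_factor_def H_factor_def by blast
  have sub: "parcs F \<subseteq> parcs G" using F(2) by (auto simp: spanning_def subgraph_def)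
  show "factorable n (parcs G) (pverts G)"
    unfolding factorable_def
    using F(3) sub pair_graphD(2)[OF G] pair_graphD(3)[OF F(1)]
    by (intro exI[of _ "parcs F"]) (auto simp: out_degree_with_proj)
next
  assume "factorable n (parcs G) (pverts G)"
  then obtain F where F: "F \<subseteq> parcs G \<inter> pverts G \<times> pverts G" "sym F"
      "\<forall>v\<in>pverts G. card (F `` {v}) \<in> H_set n"
    unfolding factorable_def by blast
  define F' where "F' = \<lparr>pverts = pverts G, parcs = F\<rparr>"
  have F': "pair_graph F'"
    using pair_graphD[OF G] F by (intro pair_graphI) (auto simp: F'_def)
  interpret F: pair_graph F' by fact
  interpret G: pair_graph G by fact
  have "wf_digraph (with_proj F')" "wf_digraph (with_proj G)" by unfold_locales
  then have "spanning (with_proj F') (with_proj G)"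
    using F(1) by (auto simp: spanning_def subgraph_def compatible_def F'_def)
  then show "has_H_factor n G"
    unfolding has_H_factor_def H_factor_def using F' F(3)
    by (intro exI[of _ F']) (auto simp: out_degree_with_proj F'_def)
qed

lemma cut_connected_of_connected:
  assumes sym: "sym (parcs G)" and conn: "connected (with_proj G \<restriction> X)"
  shows "cut_connected (parcs G) X"
proof -
  define M where "M = mk_symmetric (with_proj G \<restriction> X)"
  have M: "pverts M = X" "parcs M = parcs G \<inter> X \<times> X"
    using symD[OF sym] by (auto simp: M_def mk_symmetric_def)
  have reach: "(u, v) \<in> rtrancl_on X (parcs G \<inter> X \<times> X)" if "u \<in> X" "v \<in> X" for u v
    using conn that M unfolding connected_def strongly_connected_def reachable_def M_def[symmetric]
    by simp
  have "X \<noteq> {}" using conn M by (simp add: connected_def strongly_connected_def flip: M_def)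
  moreover have "\<exists>a\<in>A. \<exists>b\<in>X - A. (a, b) \<in> parcs G" if A: "A \<subseteq> X" "A \<noteq> {}" "A \<noteq> X" for A
  proof (rule ccontr)
    assume no: "\<not> ?thesis"
    obtain a b where ab: "a \<in> A" "b \<in> X" "b \<notin> A" using A by blast
    then have "(a, b) \<in> rtrancl_on X (parcs G \<inter> X \<times> X)" using A by (intro reach) auto
    then have "b \<in> A" by (induction rule: rtrancl_on_induct) (use ab no in auto)
    then show False using ab by blast
  qed
  ultimately show ?thesis unfolding cut_connected_def by blast
qed

text \<open>
  The extremal graph stays connected after fewer than \<open>k\<close> deletions because one of its hubs survives.
\<close>

lemma connected_of_hub:
  assumes sym: "sym (parcs G)" and c: "c \<in> X" "\<And>v. v \<in> X \<Longrightarrow> v \<noteq> c \<Longrightarrow> (c, v) \<in> parcs G"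
  shows "connected (with_proj G \<restriction> X)"
proof -
  define M where "M = mk_symmetric (with_proj G \<restriction> X)"
  have M: "pverts M = X" "parcs M = parcs G \<inter> X \<times> X"
    using symD[OF sym] by (auto simp: M_def mk_symmetric_def)
  have out: "(c, v) \<in> rtrancl_on X (parcs M)" if "v \<in> X" for v
    using that c M rtrancl_on_into_rtrancl_on[OF rtrancl_on_refl[of c X], of v "parcs M"]
    by (cases "v = c") auto
  have into: "(v, c) \<in> rtrancl_on X (parcs M)" if "v \<in> X" for v
    using that c M symD[OF sym] rtrancl_on_into_rtrancl_on[OF rtrancl_on_refl[of v X], of c "parcs M"]
    by (cases "v = c") auto
  have "(v, w) \<in> rtrancl_on X (parcs M)" if "v \<in> X" "w \<in> X" for v w
    by (rule rtrancl_on_trans[OF into[OF that(1)] out[OF that(2)]])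
  then show ?thesis
    using c(1) M by (auto simp: connected_def strongly_connected_def reachable_def simp flip: M_def)
qed

section \<open>Adding an edge between two vertices with many neighbours\<close>

text \<open>
  A component containing neither \<open>u\<close> nor \<open>v\<close> contributes a vertex adjacent to neither of them.
  At most two components contain \<open>u\<close> or \<open>v\<close>, and \<open>u\<close>, \<open>v\<close> themselves make up for these.
\<close>

lemma card_nonneighbors:
  assumes fin: "finite X" and sym: "sym E" and uv: "u \<in> X" "v \<in> X" "u \<noteq> v"
  shows "card (components E X) \<le> card ({u, v} \<union> {x \<in> X. (u, x) \<notin> E \<and> (v, x) \<notin> E})" (is "_ \<le> card ?Z")
proof -
  obtain Cu Cv where C: "Cu \<in> components E X" "u \<in> Cu" "Cv \<in> components E X" "v \<in> Cv"
    using component_exists[OF fin sym] uv by metis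
  define \<D> where "\<D> = components E X - {Cu, Cv}"
  have "\<forall>D\<in>\<D>. \<exists>x. x \<in> D" using componentsD(3) unfolding \<D>_def by blast
  then obtain r where r: "\<And>D. D \<in> \<D> \<Longrightarrow> r D \<in> D" by metis
  have inj: "inj_on r \<D>"
  proof (rule inj_onI)
    fix D D' assume "D \<in> \<D>" "D' \<in> \<D>" "r D = r D'"
    then show "D = D'"
      using r[of D] r[of D'] component_eqI[of D E X D' "r D"] by (simp add: \<D>_def)
  qed
  have rZ: "r D \<in> ?Z - {u, v}" if D: "D \<in> \<D>" for D
  proof -
    have comp: "D \<in> components E X" and ne: "D \<noteq> Cu" "D \<noteq> Cv" using D by (auto simp: \<D>_def)
    have rX: "r D \<in> X" using componentsD(1)[OF comp] r[OF D] by blast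
    have "r D \<notin> Cu" "r D \<notin> Cv"
      using ne r[OF D] component_eqI[OF comp C(1)] component_eqI[OF comp C(3)] by blast+
    then show ?thesis using rX C(2,4) componentsD(4)[OF C(1,2)] componentsD(4)[OF C(3,4)] by blast
  qed
  have finZ: "finite ?Z" using fin by simp
  have "card \<D> \<le> card (?Z - {u, v})" using inj rZ finZ by (intro card_inj_on_le[of r]) auto
  moreover have "card (?Z - {u, v}) = card ?Z - card {u, v}"
    using finZ by (intro card_Diff_subset) auto
  moreover have "card {u, v} = 2" using uv(3) by simp
  moreover have "card (components E X) \<le> card \<D> + 2"
  proof -
    have "card (components E X) - card {Cu, Cv} \<le> card \<D>"
      unfolding \<D>_def by (intro diff_card_le_card_Diff) simp
    moreover have "card {Cu, Cv} \<le> 2" by (simp add: card_insert_if)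
    ultimately show ?thesis by linarith
  qed
  moreover have "card {u, v} \<le> card ?Z" using finZ by (intro card_mono) auto
  ultimately show ?thesis by linarith
qed

lemma has_H_factor_add_edge_iff:
  fixes G :: "'a pair_pre_digraph"
  assumes n: "n \<ge> 2" and k: "k \<ge> 1" and adm: "admissible k G u v"
    and bound: "int (card (neighbors G u \<union> neighbors G v)) \<ge> int (card (pverts G)) - 2 * int n * int k"
  shows "has_H_factor n G \<longleftrightarrow> has_H_factor n (add_edge G u v)"
proof -
  have G: "pair_graph G" and kconn: "k_connected k G" and even: "even (card (pverts G))"
    and uv: "u \<in> pverts G" "v \<in> pverts G" "u \<noteq> v" "(u, v) \<notin> parcs G"
    using adm by (auto simp: admissible_def)
  define W E where "W = pverts G" and "E = parcs G"
  have fin: "finite W" and EW: "E \<subseteq> W \<times> W" and sym: "sym E" and irrefl: "\<And>v. (v, v) \<notin> E"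
    using pair_graphD[OF G] by (auto simp: W_def E_def)
  have conn: "cut_connected E (W - S)" if "S \<subseteq> W" "card S < k" for S
    using kconn that sym unfolding k_connected_def W_def E_def
    by (intro cut_connected_of_connected) auto
  have iff: "has_H_factor n G \<longleftrightarrow> factorable n E W"
      "has_H_factor n (add_edge G u v) \<longleftrightarrow> factorable n (E \<union> {(u, v), (v, u)}) W"
    using has_H_factor_iff_factorable[OF G]
      has_H_factor_iff_factorable[OF pair_graph_add_edge[OF G uv(1-3)]]
    by (auto simp: W_def E_def add_edge_def)
  have "factorable n E W" if fact: "factorable n (E \<union> {(u, v), (v, u)}) W"
  proof (rule ccontr)
    assume not: "\<not> factorable n E W"
    have "cut_connected E W" using conn[of "{}"] k by simp
    then have "\<not> tutte_condition n E W"
      using factorable_of_tutte_condition[OF n fin sym] even not unfolding W_def by blast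
    then obtain S where S: "S \<subseteq> W" "S \<noteq> {}" "2 * n * card S < card (bad_components n E (W - S))"
      unfolding tutte_condition_def by (auto simp: not_le)
    have finS: "finite S" using S(1) fin finite_subset by blast
    then have "card S \<ge> 1" using S(2) by (simp add: Suc_le_eq card_gt_0_iff)
    then have big: "2 * n * card S \<ge> 1" using n by simp
    have le: "card (bad_components n E (W - S)) \<le> card (components E (W - S))"
      using fin by (intro card_mono finite_components) (auto simp: bad_components_def)
    have "card S \<ge> k"
    proof (rule ccontr)
      assume "\<not> card S \<ge> k"
      then have "components E (W - S) = {W - S}"
        using conn[OF S(1)] by (intro components_cut_connected) simp
      then show False using le S(3) big by simp
    qed
    show False
    proof (cases "u \<in> S \<or> v \<in> S")
      case True
      have "card (bad_components n E (W - S)) \<le> 2 * n * card S"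
        using n True by (intro card_bad_components_le_of_factor[OF _ fin sym S(1) fact]) auto
      then show False using S(3) by simp
    next
      case False
      have "card (components E (W - S)) \<le>
          card ({u, v} \<union> {x \<in> W - S. (u, x) \<notin> E \<and> (v, x) \<notin> E})"
        using uv False fin by (intro card_nonneighbors[OF _ sym]) (auto simp: W_def)
      also have "\<dots> \<le> card (W - (E `` {u} \<union> E `` {v}))"
      proof (rule card_mono)
        have "(v, u) \<notin> E" using uv(4) symD[OF sym, of v u] by (auto simp: E_def)
        then show "{u, v} \<union> {x \<in> W - S. (u, x) \<notin> E \<and> (v, x) \<notin> E} \<subseteq> W - (E `` {u} \<union> E `` {v})"
          using uv irrefl by (auto simp: W_def E_def)
      qed (use fin in simp)
      also have "\<dots> = card W - card (E `` {u} \<union> E `` {v})"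
        using EW fin by (intro card_Diff_subset) (auto intro: finite_subset[of _ W])
      finally have "2 * n * card S < card W - card (E `` {u} \<union> E `` {v})" using le S(3) by linarith
      moreover have "2 * n * k \<le> 2 * n * card S" using \<open>card S \<ge> k\<close> by (rule mult_le_mono2)
      ultimately have "2 * n * k + card (E `` {u} \<union> E `` {v}) < card W" by linarith
      then have "int (2 * n * k + card (E `` {u} \<union> E `` {v})) < int (card W)" by (simp only: of_nat_less_iff)
      then show False using bound by (simp add: neighbors_Image W_def E_def)
    qed
  qed
  then show ?thesis using iff factorable_mono[of n E W] by blast
qed

section \<open>Sharpness\<close>

text \<open>
  The complete graph on the hubs \<open>{..<k}\<close>, joined completely to \<open>m\<close> independent vertices.
\<close>

definition extremal_graph :: "nat \<Rightarrow> nat \<Rightarrow> nat pair_pre_digraph" where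
  "extremal_graph k m =
     \<lparr>pverts = {..<k + m}, parcs = {(a, b). a < k + m \<and> b < k + m \<and> a \<noteq> b \<and> (a < k \<or> b < k)}\<rparr>"

lemma sym_extremal_graph: "sym (parcs (extremal_graph k m))"
  by (auto simp: extremal_graph_def intro: symI)

lemma pair_graph_extremal_graph: "pair_graph (extremal_graph k m)"
  by (rule pair_graphI[OF _ _ sym_extremal_graph]) (auto simp: extremal_graph_def)

lemma k_connected_extremal_graph: "k_connected k (extremal_graph k m)"
  unfolding k_connected_def
proof (intro allI impI)
  fix S assume S: "S \<subseteq> pverts (extremal_graph k m)" "card S < k"
  have finS: "finite S" using S(1) by (rule finite_subset) (simp add: extremal_graph_def)
  have "\<not> {..<k} \<subseteq> S" using S(2) card_mono[OF finS, of "{..<k}"] by auto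
  then obtain c where c: "c < k" "c \<notin> S" by auto
  show "connected (with_proj (extremal_graph k m) \<restriction> (pverts (extremal_graph k m) - S))"
    by (rule connected_of_hub[OF sym_extremal_graph, of c]) (use c in \<open>auto simp: extremal_graph_def\<close>)
qed

lemma neighbors_extremal_graph:
  assumes "k \<le> v" "v < k + m"
  shows "neighbors (extremal_graph k m) v = {..<k}"
  using assms by (auto simp: neighbors_Image extremal_graph_def)

text \<open>
  Without the hubs, the independent vertices are bad components of order one.
\<close>

lemma extremal_graph_not_factorable:
  assumes n: "n \<ge> 1" and m: "m > 2 * n * k"
  shows "\<not> factorable n (parcs (extremal_graph k m)) {..<k + m}" (is "\<not> factorable n ?E ?W")
proof
  assume "factorable n ?E ?W"
  then have le: "card (bad_components n ?E (?W - {..<k})) \<le> 2 * n * card {..<k}"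
    using n by (intro card_bad_components_le_of_factor[OF _ _ sym_extremal_graph]) auto
  have "{j} \<in> bad_components n ?E (?W - {..<k})" if j: "j \<in> {k..<k + m}" for j
  proof -
    have "cut_connected ?E {j}" unfolding cut_connected_def by blast
    moreover have "(j, b) \<notin> ?E" if "b \<in> ?W - {..<k}" for b
      using j that by (auto simp: extremal_graph_def)
    moreover have "?E \<inter> {j} \<times> {j} = {}" by (auto simp: extremal_graph_def)
    then have "\<not> factorable n ?E {j}"
      using zero_notin_H_set[OF n] by (simp add: factorable_def)
    ultimately show ?thesis using j by (auto simp: bad_components_def components_def)
  qed
  then have "(\<lambda>j. {j}) ` {k..<k + m} \<subseteq> bad_components n ?E (?W - {..<k})" by blast
  then have "card ((\<lambda>j. {j}) ` {k..<k + m}) \<le> card (bad_components n ?E (?W - {..<k}))"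
    by (intro card_mono finite_bad_components) auto
  then show False using le m by (simp add: card_image)
qed

text \<open>
  The two ends of the new edge are matched with each other, and the other \<open>2nk - 1\<close> independent
  vertices are distributed to the hubs in consecutive blocks of \<open>2n\<close>. Only the last block is one
  short, so the hub degrees are \<open>2n\<close> and, once, \<open>2n - 1\<close>.
\<close>

lemma extremal_graph_add_edge_factorable:
  assumes n: "n \<ge> 1" and k: "k \<ge> 1" and m: "m = 2 * n * k + 1"
  shows "factorable n (parcs (add_edge (extremal_graph k m) k (Suc k))) {..<k + m}"
    (is "factorable n ?E ?W")
proof -
  define hub where "hub j = (j - (k + 2)) div (2 * n)" for j
  define F where "F = {(k, Suc k), (Suc k, k)} \<union>
    {(a, b). a \<in> {k + 2..<k + m} \<and> b = hub a \<or> b \<in> {k + 2..<k + m} \<and> a = hub b}"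
  have nk: "2 * n * k \<ge> 2" using mult_le_mono[OF n k] by simp
  have hub: "hub j < k" if "j \<in> {k + 2..<k + m}" for j
  proof -
    have "j - (k + 2) < 2 * n * k" using that m by auto
    also have "2 * n * k = k * (2 * n)" by (rule mult.commute)
    finally have "j - (k + 2) < k * (2 * n)" .
    then show ?thesis unfolding hub_def by (rule less_mult_imp_div_less)
  qed
  have spoke: "(a, b) \<in> ?E \<inter> ?W \<times> ?W \<and> (b, a) \<in> ?E \<inter> ?W \<times> ?W"
    if "a \<in> {k + 2..<k + m}" "b = hub a" for a b
    using hub[OF that(1)] that by (auto simp: add_edge_def extremal_graph_def)
  have "(k, Suc k) \<in> ?E \<inter> ?W \<times> ?W" "(Suc k, k) \<in> ?E \<inter> ?W \<times> ?W"
    using nk m by (auto simp: add_edge_def)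
  then have "F \<subseteq> ?E \<inter> ?W \<times> ?W" using spoke unfolding F_def by blast
  moreover have "sym F" by (auto simp: F_def intro: symI)
  moreover have "card (F `` {v}) \<in> H_set n" if v: "v \<in> ?W" for v
  proof -
    have one: "1 \<in> H_set n" using n by (auto simp: H_set_def)
    consider "v < k" | "v = k" | "v = Suc k" | "v \<in> {k + 2..<k + m}" using v by fastforce
    then show ?thesis
    proof cases
      case 1
      have "F `` {v} = {j \<in> {k + 2..<k + m}. hub j = v}" using 1 by (auto simp: F_def)
      also have "\<dots> = {k + 2 + 2 * n * v..<min (k + 2 + 2 * n * Suc v) (k + m)}"
      proof (intro set_eqI)
        fix j
        have "hub j = v \<longleftrightarrow> 2 * n * v \<le> j - (k + 2) \<and> j - (k + 2) < 2 * n * Suc v"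
        proof
          assume "hub j = v"
          then show "2 * n * v \<le> j - (k + 2) \<and> j - (k + 2) < 2 * n * Suc v"
            using n dividend_less_times_div[of "2 * n" "j - (k + 2)"]
              times_div_less_eq_dividend[of "2 * n" "j - (k + 2)"]
            unfolding hub_def by simp
        next
          assume "2 * n * v \<le> j - (k + 2) \<and> j - (k + 2) < 2 * n * Suc v"
          then show "hub j = v" unfolding hub_def by (intro div_nat_eqI) (simp_all add: mult.commute)
        qed
        then show "j \<in> {j \<in> {k + 2..<k + m}. hub j = v} \<longleftrightarrow>
            j \<in> {k + 2 + 2 * n * v..<min (k + 2 + 2 * n * Suc v) (k + m)}" by auto
      qed
      finally have F: "card (F `` {v}) = min (k + 2 + 2 * n * Suc v) (k + m) - (k + 2 + 2 * n * v)"
        by simp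
      show ?thesis
      proof (cases "Suc v = k")
        case True
        then have "k + m = k + 1 + 2 * n * Suc v" using m by simp
        then have "min (k + 2 + 2 * n * Suc v) (k + m) = k + 1 + 2 * n * Suc v" by linarith
        then have "card (F `` {v}) = 2 * n - 1" unfolding F by simp
        then show ?thesis using n by (auto simp: H_set_def)
      next
        case False
        then have "2 * n * (Suc v + 1) \<le> 2 * n * k" using 1 by (intro mult_le_mono2) simp
        then have "k + 2 + 2 * n * Suc v \<le> k + m" using m n by simp
        then have "min (k + 2 + 2 * n * Suc v) (k + m) = k + 2 + 2 * n * Suc v" by linarith
        then have "card (F `` {v}) = 2 * n" unfolding F by simp
        then show ?thesis by (simp add: H_set_def)
      qed
    next
      case 2
      then have "F `` {v} = {Suc k}" using hub by (fastforce simp: F_def)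
      then show ?thesis using one by simp
    next
      case 3
      then have "F `` {v} = {k}" using hub by (fastforce simp: F_def)
      then show ?thesis using one by simp
    next
      case 4
      then have "F `` {v} = {hub v}" using hub by (fastforce simp: F_def)
      then show ?thesis using one by simp
    qed
  qed
  ultimately show ?thesis unfolding factorable_def by blast
qed

lemma bound_best_possible:
  assumes n: "n \<ge> 1" and k: "odd k"
  shows "\<exists>(G :: nat pair_pre_digraph) u v. admissible k G u v \<and>
    int (card (neighbors G u \<union> neighbors G v)) = int (card (pverts G)) - 2 * int n * int k - 1 \<and>
    \<not> (has_H_factor n G \<longleftrightarrow> has_H_factor n (add_edge G u v))"
proof -
  define m where "m = 2 * n * k + 1"
  define G where "G = extremal_graph k m"
  have k1: "k \<ge> 1" using k by (cases k) auto
  have "2 * n * k \<ge> 2" using mult_le_mono[OF n k1] by simp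
  then have mem: "k < k + m" "Suc k < k + m" by (auto simp: m_def)
  have verts: "pverts G = {..<k + m}" by (simp add: G_def extremal_graph_def)
  have G: "pair_graph G" unfolding G_def by (rule pair_graph_extremal_graph)
  have "(k, Suc k) \<notin> parcs G" by (simp add: G_def extremal_graph_def)
  moreover have "k_connected k G" unfolding G_def by (rule k_connected_extremal_graph)
  moreover have "even (card (pverts G))" using k by (simp add: verts m_def)
  ultimately have "admissible k G k (Suc k)"
    using G mem by (simp add: admissible_def verts)
  moreover have "neighbors G k \<union> neighbors G (Suc k) = {..<k}"
    using mem unfolding G_def by (simp add: neighbors_extremal_graph)
  then have "int (card (neighbors G k \<union> neighbors G (Suc k))) =
      int (card (pverts G)) - 2 * int n * int k - 1"
    by (simp add: verts m_def)
  moreover have "\<not> has_H_factor n G"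
    using extremal_graph_not_factorable[OF n, of k m] has_H_factor_iff_factorable[OF G] verts
    unfolding G_def m_def by simp
  moreover have add: "pair_graph (add_edge G k (Suc k))"
    using mem verts by (intro pair_graph_add_edge[OF G]) auto
  have "pverts (add_edge G k (Suc k)) = {..<k + m}" by (simp add: add_edge_def verts)
  then have "has_H_factor n (add_edge G k (Suc k))"
    using extremal_graph_add_edge_factorable[OF n k1 m_def] has_H_factor_iff_factorable[OF add]
    unfolding G_def by simp
  ultimately show ?thesis by blast
qed

theorem theorem3p3:
  fixes n :: nat
  assumes "n \<ge> 2"
  shows
    "(\<forall>k (G :: 'a pair_pre_digraph) u v.
        k \<ge> 1 \<longrightarrow> admissible k G u v \<longrightarrow>
        int (card (neighbors G u \<union> neighbors G v))
          \<ge> int (card (pverts G)) - 2 * int n * int k \<longrightarrow>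
        (has_H_factor n G \<longleftrightarrow> has_H_factor n (add_edge G u v)))
     \<and>
     (\<forall>k. odd k \<longrightarrow>
        (\<exists>(G :: nat pair_pre_digraph) u v.
           admissible k G u v \<and>
           int (card (neighbors G u \<union> neighbors G v))
             = int (card (pverts G)) - 2 * int n * int k - 1 \<and>
           \<not> (has_H_factor n G \<longleftrightarrow> has_H_factor n (add_edge G u v))))"
proof (intro conjI allI impI)
  fix k :: nat and G :: "'a pair_pre_digraph" and u v
  assume "k \<ge> 1" "admissible k G u v"
    and "int (card (neighbors G u \<union> neighbors G v)) \<ge> int (card (pverts G)) - 2 * int n * int k"
  then show "has_H_factor n G \<longleftrightarrow> has_H_factor n (add_edge G u v)"
    by (rule has_H_factor_add_edge_iff[OF assms])
next
  fix k :: nat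
  assume "odd k"
  moreover have "n \<ge> 1" using assms by simp
  ultimately show "\<exists>(G :: nat pair_pre_digraph) u v. admissible k G u v \<and>
      int (card (neighbors G u \<union> neighbors G v)) = int (card (pverts G)) - 2 * int n * int k - 1 \<and>
      \<not> (has_H_factor n G \<longleftrightarrow> has_H_factor n (add_edge G u v))"
    by (intro bound_best_possible)
qed

end
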